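(* Let $n$ be even and let $\xi=(n,n/2,\lambda)\in\mathfrak{P}^{\mathrm{stab}}(n)$. Then $$\mathfrak{c}(\xi)=f_\lambda(ht^{-1},ht^{-2},\dots)\,v_{\Lambda_0}.$$
   Context: Affine Lie algebra. $\mathfrak{sl}_2$ is the complex Lie algebra of trace-zero $2\times2$ matrices with standard basis $x=\begin{pmatrix}0&1\\0&0\end{pmatrix}$, $h=\begin{pmatrix}1&0\\0&-1\end{pmatrix}$, $y=\begin{pmatrix}0&0\\1&0\end{pmatrix}$ and form $(A,B)=\mathrm{trace}(AB)$. $\widehat{\mathfrak{sl}_2}=\mathfrak{sl}_2\otimes\mathbb{C}[t,t^{-1}]\oplus\mathbb{C}c\oplus\mathbb{C}d$, where $At^m$ means $A\otimes t^m$, $c$ is central, $[At^m,Bt^n]=[A,B]t^{m+n}+m\,\delta_{m,-n}(A,B)c$ and $[d,At^m]=mAt^m$. Chevalley generators: $e_1=x$, $f_1=y$, $e_0=yt$, $f_0=xt^{-1}$; simple coroots $\alpha_1^\vee=h$, $\alpha_0^\vee=c-h$. $\Lambda_0$ is the linear functional on $\mathbb{C}h\oplus\mathbb{C}c\oplus\mathbb{C}d$ with values $0,1,0$ on $h,c,d$; $L(\Lambda_0)$ is the irreducible $\widehat{\mathfrak{sl}_2}$-module with highest weight $\Lambda_0$ and highest weight vector $v_{\Lambda_0}$. Divided powers: $X^{(p)}=X^p/p!$. For even $n\ge0$, $w_n=(xt^{-n/2})^{(n/2)}v_{\Lambda_0}$. A partition $\lambda=(\lambda_1\ge\lambda_2\ge\cdots)$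 is a weakly decreasing sequence of non-negative integers, eventually zero; $|\lambda|=\sum_i\lambda_i$, $\lambda\vdash r$ means $|\lambda|=r$, and $\mathrm{supp}\,\lambda$ is the number of non-zero parts. $\mathfrak{P}(n)$ is the set of triples $(n,k,\lambda)$ with $k$ an integer, $0\le k\le n$, and $\lambda$ a partition with $\lambda_1\le k$ and $\mathrm{supp}\,\lambda\le n-k$. For $n$ even, $\mathfrak{P}^{\mathrm{stab}}(n)=\{(n,k,\lambda)\in\mathfrak{P}(n):|\lambda|\le\min(n-k,k)\}$, and for $\xi=(n,k,\lambda)\in\mathfrak{P}(n)$ $$\mathfrak{c}(\xi)=z(\xi)\Big(\prod_{i=1}^{n-k}yt^{k-\lambda_i}\Big)w_n\in L(\Lambda_0),\qquad z(\xi)=\frac{(-1)^{[n/4]-[(n-k)/2]}}{\prod_{j=0}^k m_j!},$$ where $[\cdot]$ is the floor function, $m_j=\#\{i:\lambda_i=j\}$ for $j\ge1$, and $m_0=n-k-\mathrm{supp}\,\lambda$. The polynomial $f_\lambda$. Let $r=\mathrm{supp}\,\lambda$. If $r=0$ put $f_\lambda=1$. If $r\ge1$, for $\pi\vdash r$ with $s=\mathrm{supp}\,\pi$ let $\mathcal{Y}(\pi)$ be the set of all set partitions $B=\{B_1,\dots,B_s\}$ of $\{1,\dots,r\}$ of type $\pi$ (unordered collections of pairwise disjoint subsets with union $\{1,\dots,r\}$ and block sizes $|B_i|=\pi_i$), and set $$\mathcal{H}(\pi,\lambda)=\sum_{B\in\mathcal{Y}(\pi)}\ \prod_{p=1}^s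 ht^{-\sum_{j\in B_p}\lambda_j},\qquad C'(\pi)=\prod_{i=1}^{s}(\pi_i-1)!,$$ $$f_\lambda(ht^{-1},ht^{-2},\dots)=\frac{(-1)^r}{\prod_{j\ge1}m_j(\lambda)!}\sum_{\pi\vdash r}C'(\pi)\,\mathcal{H}(\pi,\lambda),$$ an element of the (commutative) universal enveloping algebra of $h\otimes t^{-1}\mathbb{C}[t^{-1}]$, where $m_j(\lambda)=\#\{i:\lambda_i=j\}$. *)

theory Defs
  imports "HOL-Analysis.Analysis" "HOL-Library.Poly_Mapping" "HOL-Library.Disjoint_Sets"
begin

type_synonym mat2 = "complex^2^2"

definition mat_x :: mat2 where "mat_x = vector [vector [0, 1], vector [0, 0]]"
definition mat_h :: mat2 where "mat_h = vector [vector [1, 0], vector [0, -1]]"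
definition mat_y :: mat2 where "mat_y = vector [vector [0, 0], vector [1, 0]]"

definition mat_scale :: "complex \<Rightarrow> mat2 \<Rightarrow> mat2" where
  "mat_scale z A = (\<chi> i j. z * A $ i $ j)"

definition commutator :: "mat2 \<Rightarrow> mat2 \<Rightarrow> mat2" where
  "commutator A B = A ** B - B ** A"

text \<open>The triple \<open>(p, a, b)\<close> stands for the sum of all \<open>A t^m\<close>, where \<open>A\<close> is the value of
  \<open>p\<close> at \<open>m\<close>, plus \<open>a c + b d\<close>. The type admits arbitrary matrices as coefficients; the Lie
  algebra itself is the set \<open>sl2hat\<close> below. Addition is that of the product type.\<close>

type_synonym affine = "(int \<Rightarrow>\<^sub>0 mat2) \<times> complex \<times> complex"

definition sl2hat :: "affine set" where
  "sl2hat = {(p, a, b). \<forall>m. trace (Poly_Mapping.lookup p m) = 0}"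

definition loop :: "mat2 \<Rightarrow> int \<Rightarrow> affine" where
  "loop A m = (Poly_Mapping.single m A, 0, 0)"

definition central :: affine where "central = (0, 1, 0)"
definition deriv_d :: affine where "deriv_d = (0, 0, 1)"

definition aff_scale :: "complex \<Rightarrow> affine \<Rightarrow> affine" where
  "aff_scale z X = (case X of (p, a, b) \<Rightarrow> (Poly_Mapping.map (mat_scale z) p, z * a, z * b))"

definition loop_commutator :: "(int \<Rightarrow>\<^sub>0 mat2) \<Rightarrow> (int \<Rightarrow>\<^sub>0 mat2) \<Rightarrow> (int \<Rightarrow>\<^sub>0 mat2)" where
  "loop_commutator p q =
    (\<Sum>m\<in>Poly_Mapping.keys p. \<Sum>n\<in>Poly_Mapping.keys q.
      Poly_Mapping.single (m + n) (commutator (Poly_Mapping.lookup p m) (Poly_Mapping.lookup q n)))"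

definition loop_deriv :: "(int \<Rightarrow>\<^sub>0 mat2) \<Rightarrow> (int \<Rightarrow>\<^sub>0 mat2)" where
  "loop_deriv p =
    (\<Sum>m\<in>Poly_Mapping.keys p. Poly_Mapping.single m (mat_scale (of_int m) (Poly_Mapping.lookup p m)))"

definition loop_cocycle :: "(int \<Rightarrow>\<^sub>0 mat2) \<Rightarrow> (int \<Rightarrow>\<^sub>0 mat2) \<Rightarrow> complex" where
  "loop_cocycle p q =
    (\<Sum>m\<in>Poly_Mapping.keys p.
      of_int m * trace (Poly_Mapping.lookup p m ** Poly_Mapping.lookup q (- m)))"

text \<open>This is the bilinear extension of the defining brackets, which are recovered in
  \<open>bracket_loop\<close>, \<open>bracket_deriv_loop\<close> and \<open>bracket_central\<close>; see \<open>bracket_skew\<close>,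
  \<open>bracket_add_left\<close> and \<open>bracket_scale_left\<close>.\<close>

definition bracket :: "affine \<Rightarrow> affine \<Rightarrow> affine" where
  "bracket X Y = (case X of (p, a, b) \<Rightarrow> case Y of (q, a', b') \<Rightarrow>
     (loop_commutator p q
        + Poly_Mapping.map (mat_scale b) (loop_deriv q)
        - Poly_Mapping.map (mat_scale b') (loop_deriv p),
      loop_cocycle p q, 0))"

lemma mat_scale_0 [simp]: "mat_scale z 0 = 0" "mat_scale 0 A = 0" "mat_scale 1 A = A"
  by (simp_all add: mat_scale_def vec_eq_iff)

lemma mat_scale_add:
  "mat_scale z (A + B) = mat_scale z A + mat_scale z B"
  "mat_scale (z + w) A = mat_scale z A + mat_scale w A"
  by (simp_all add: mat_scale_def vec_eq_iff algebra_simps)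

lemma mat_scale_diff: "mat_scale z (A - B) = mat_scale z A - mat_scale z B"
  by (simp add: mat_scale_def vec_eq_iff algebra_simps)

lemma mat_scale_mat_scale: "mat_scale z (mat_scale w A) = mat_scale (z * w) A"
  by (simp add: mat_scale_def vec_eq_iff)

lemma mat_scale_commutator: "commutator (mat_scale z A) B = mat_scale z (commutator A B)"
  by (simp add: commutator_def mat_scale_def matrix_matrix_mult_def vec_eq_iff sum_2 algebra_simps)

lemma commutator_add: "commutator (A + B) C = commutator A C + commutator B C"
  by (simp add: commutator_def matrix_matrix_mult_def vec_eq_iff sum_2 algebra_simps)

lemma trace_mult_add: "trace ((A + B) ** C) = trace (A ** C) + trace (B ** (C :: mat2))"
  by (simp add: trace_def matrix_matrix_mult_def sum_2 algebra_simps)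

lemma trace_mat_scale: "trace (mat_scale z A ** B) = z * trace (A ** B)"
  by (simp add: trace_def mat_scale_def matrix_matrix_mult_def sum_2 algebra_simps)

lemma map_mat_scale [simp]:
  "Poly_Mapping.lookup (Poly_Mapping.map (mat_scale z) p) m = mat_scale z (Poly_Mapping.lookup p m)"
  by (simp add: Poly_Mapping.map.rep_eq when_def)

lemma map_mat_scale_simps [simp]:
  "Poly_Mapping.map (mat_scale 0) p = 0" "Poly_Mapping.map (mat_scale 1) p = p"
  "Poly_Mapping.map (mat_scale z) 0 = 0"
  "Poly_Mapping.map (mat_scale z) (Poly_Mapping.single m A) = Poly_Mapping.single m (mat_scale z A)"
  by (rule poly_mapping_eqI, simp add: lookup_single when_def)+

lemma commutator_simps [simp]:
  "commutator 0 A = 0" "commutator A 0 = 0"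
  by (simp_all add: commutator_def)

lemma trace_0_mat2 [simp]: "trace (0 :: mat2) = 0"
  by (simp add: trace_def)

lemma bracket_loop:
  "bracket (loop A m) (loop B n) =
     loop (commutator A B) (m + n)
     + aff_scale (of_int m * (if m = - n then 1 else 0) * trace (A ** B)) central"
  by (auto simp: bracket_def loop_def aff_scale_def central_def loop_commutator_def
      loop_cocycle_def lookup_single when_def)

lemma bracket_deriv_loop: "bracket deriv_d (loop A m) = aff_scale (of_int m) (loop A m)"
  by (auto simp: bracket_def loop_def aff_scale_def deriv_d_def loop_commutator_def
      loop_cocycle_def loop_deriv_def)

lemma bracket_central: "bracket central X = 0" "bracket X central = 0"
  by (auto simp: bracket_def central_def loop_commutator_def loop_cocycle_def loop_deriv_def
      zero_prod_def split: prod.splits)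

lemma loop_commutator_superset:
  assumes "finite S" "finite T" "Poly_Mapping.keys p \<subseteq> S" "Poly_Mapping.keys q \<subseteq> T"
  shows "loop_commutator p q = (\<Sum>m\<in>S. \<Sum>n\<in>T.
    Poly_Mapping.single (m + n) (commutator (Poly_Mapping.lookup p m) (Poly_Mapping.lookup q n)))"
proof -
  have "loop_commutator p q = (\<Sum>m\<in>Poly_Mapping.keys p. \<Sum>n\<in>T.
    Poly_Mapping.single (m + n) (commutator (Poly_Mapping.lookup p m) (Poly_Mapping.lookup q n)))"
    unfolding loop_commutator_def
    by (intro sum.cong refl sum.mono_neutral_left) (use assms in \<open>auto simp: in_keys_iff\<close>)
  also have "\<dots> = (\<Sum>m\<in>S. \<Sum>n\<in>T.
    Poly_Mapping.single (m + n) (commutator (Poly_Mapping.lookup p m) (Poly_Mapping.lookup q n)))"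
    by (intro sum.mono_neutral_left) (use assms in \<open>auto simp: in_keys_iff\<close>)
  finally show ?thesis .
qed

lemma loop_deriv_superset:
  assumes "finite S" "Poly_Mapping.keys p \<subseteq> S"
  shows "loop_deriv p =
    (\<Sum>m\<in>S. Poly_Mapping.single m (mat_scale (of_int m) (Poly_Mapping.lookup p m)))"
  unfolding loop_deriv_def
  by (intro sum.mono_neutral_left) (use assms in \<open>auto simp: in_keys_iff\<close>)

lemma loop_cocycle_superset:
  assumes "finite S" "Poly_Mapping.keys p \<subseteq> S"
  shows "loop_cocycle p q =
    (\<Sum>m\<in>S. of_int m * trace (Poly_Mapping.lookup p m ** Poly_Mapping.lookup q (- m)))"
  unfolding loop_cocycle_def
  by (intro sum.mono_neutral_left) (use assms in \<open>auto simp: in_keys_iff\<close>)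

lemma bracket_skew: "bracket Y X = - bracket X Y"
proof -
  have C: "loop_commutator q p = - loop_commutator p q" for p q
  proof -
    have "loop_commutator q p = (\<Sum>n\<in>Poly_Mapping.keys p. \<Sum>m\<in>Poly_Mapping.keys q.
        Poly_Mapping.single (m + n) (commutator (Poly_Mapping.lookup q m) (Poly_Mapping.lookup p n)))"
      unfolding loop_commutator_def by (rule sum.swap)
    also have "\<dots> = - loop_commutator p q"
      unfolding loop_commutator_def sum_negf [symmetric]
      by (intro sum.cong refl) (simp add: commutator_def add.commute flip: single_uminus)
    finally show ?thesis .
  qed
  have D: "loop_cocycle q p = - loop_cocycle p q" for p q
  proof -
    define S where "S = (Poly_Mapping.keys p \<union> Poly_Mapping.keys q)
      \<union> uminus ` (Poly_Mapping.keys p \<union> Poly_Mapping.keys q)"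
    have S: "finite S" "Poly_Mapping.keys p \<subseteq> S" "Poly_Mapping.keys q \<subseteq> S"
      by (auto simp: S_def)
    have "bij_betw uminus S S"
      by (rule bij_betwI[where g = uminus]) (auto simp: S_def)
    then have "loop_cocycle q p = (\<Sum>m\<in>S. of_int (- m) *
        trace (Poly_Mapping.lookup q (- m) ** Poly_Mapping.lookup p (- (- m))))"
      unfolding loop_cocycle_superset[OF S(1) S(3)]
      by (rule sum.reindex_bij_betw[symmetric])
    also have "\<dots> = - loop_cocycle p q"
      unfolding loop_cocycle_superset[OF S(1) S(2)] sum_negf [symmetric]
      by (intro sum.cong refl, subst trace_mul_sym) simp
    finally show ?thesis .
  qed
  obtain p a b q a' b' where XY: "X = (p, a, b)" "Y = (q, a', b')"
    by (metis prod_cases3)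
  show ?thesis
    by (simp add: XY bracket_def C[of q p] D[of q p])
qed

lemma bracket_add_left: "bracket (X + X') Y = bracket X Y + bracket X' Y"
proof -
  have C: "loop_commutator (p + p') q = loop_commutator p q + loop_commutator p' q" for p p' q
  proof -
    define S where "S = Poly_Mapping.keys p \<union> Poly_Mapping.keys p'"
    have S: "finite S" "Poly_Mapping.keys p \<subseteq> S" "Poly_Mapping.keys p' \<subseteq> S"
        "Poly_Mapping.keys (p + p') \<subseteq> S"
      using keys_add[of p p'] by (auto simp: S_def)
    show ?thesis
      unfolding S(2-4)[THEN loop_commutator_superset[OF S(1) finite_keys _ order_refl]]
      by (simp add: lookup_add commutator_add single_add sum.distrib)
  qed
  have D: "loop_cocycle (p + p') q = loop_cocycle p q + loop_cocycle p' q"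
    "loop_deriv (p + p') = loop_deriv p + loop_deriv p'" for p p' q
  proof -
    define S where "S = Poly_Mapping.keys p \<union> Poly_Mapping.keys p'"
    have S: "finite S" "Poly_Mapping.keys p \<subseteq> S" "Poly_Mapping.keys p' \<subseteq> S"
        "Poly_Mapping.keys (p + p') \<subseteq> S"
      using keys_add[of p p'] by (auto simp: S_def)
    show "loop_cocycle (p + p') q = loop_cocycle p q + loop_cocycle p' q"
      unfolding S(2-4)[THEN loop_cocycle_superset[OF S(1)]]
      by (simp add: lookup_add trace_mult_add distrib_left sum.distrib)
    show "loop_deriv (p + p') = loop_deriv p + loop_deriv p'"
      unfolding S(2-4)[THEN loop_deriv_superset[OF S(1)]]
      by (simp add: lookup_add mat_scale_add single_add sum.distrib)
  qed
  have E: "Poly_Mapping.map (mat_scale z) (p + p')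
      = Poly_Mapping.map (mat_scale z) p + Poly_Mapping.map (mat_scale z) p'"
    "Poly_Mapping.map (mat_scale (z + z')) p
      = Poly_Mapping.map (mat_scale z) p + Poly_Mapping.map (mat_scale z') p" for z z' p p'
    by (rule poly_mapping_eqI, simp add: lookup_add mat_scale_add)+
  show ?thesis
    by (cases X; cases X'; cases Y) (simp add: bracket_def C D E)
qed

lemma bracket_scale_left: "bracket (aff_scale z X) Y = aff_scale z (bracket X Y)"
proof -
  let ?s = "Poly_Mapping.map (mat_scale z)"
  have K: "Poly_Mapping.keys (?s p) \<subseteq> Poly_Mapping.keys p" for p
    by (auto simp: in_keys_iff)
  have A: "?s (p + p') = ?s p + ?s p'" "?s (p - p') = ?s p - ?s p'"
    "Poly_Mapping.map (mat_scale w) (?s p) = ?s (Poly_Mapping.map (mat_scale w) p)"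
    "?s (Poly_Mapping.map (mat_scale w) p) = Poly_Mapping.map (mat_scale (z * w)) p" for p p' w
    by (rule poly_mapping_eqI,
        simp add: lookup_add lookup_minus mat_scale_add mat_scale_diff mat_scale_mat_scale ac_simps)+
  have sum: "?s (sum g T) = (\<Sum>t\<in>T. ?s (g t))" for g and T :: "int set"
    by (induction T rule: infinite_finite_induct) (simp_all add: A)
  have "loop_commutator (?s p) q = ?s (loop_commutator p q)" for p q
    unfolding loop_commutator_superset[OF finite_keys finite_keys K order_refl]
    by (simp add: loop_commutator_def sum mat_scale_commutator)
  moreover have "loop_cocycle (?s p) q = z * loop_cocycle p q" for p q
    unfolding loop_cocycle_superset[OF finite_keys K]
    by (simp add: loop_cocycle_def sum_distrib_left trace_mat_scale ac_simps)
  moreover have "loop_deriv (?s p) = ?s (loop_deriv p)" for p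
    unfolding loop_deriv_superset[OF finite_keys K]
    by (simp add: loop_deriv_def sum mat_scale_mat_scale ac_simps)
  ultimately show ?thesis
    by (cases X; cases Y) (simp add: bracket_def aff_scale_def A)
qed

definition chev_e1 :: affine where "chev_e1 = loop mat_x 0"
definition chev_e0 :: affine where "chev_e0 = loop mat_y 1"

definition cartan :: "affine set" where
  "cartan = {aff_scale u (loop mat_h 0) + aff_scale a central + aff_scale b deriv_d | u a b. True}"

definition Lambda0 :: "affine \<Rightarrow> complex" where
  "Lambda0 X = fst (snd X)"

lemma Lambda0_cartan:
  "Lambda0 (aff_scale u (loop mat_h 0) + aff_scale a central + aff_scale b deriv_d)
     = u * 0 + a * 1 + b * 0"
  by (simp add: Lambda0_def aff_scale_def loop_def central_def deriv_d_def)

locale sl2hat_module = vector_space smul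
  for smul :: "complex \<Rightarrow> 'v \<Rightarrow> 'v::ab_group_add" +
  fixes act :: "affine \<Rightarrow> 'v \<Rightarrow> 'v"
  assumes act_linear: "X \<in> sl2hat \<Longrightarrow> Vector_Spaces.linear smul smul (act X)"
    and act_add: "X \<in> sl2hat \<Longrightarrow> Y \<in> sl2hat \<Longrightarrow> act (X + Y) u = act X u + act Y u"
    and act_scale: "X \<in> sl2hat \<Longrightarrow> act (aff_scale z X) u = smul z (act X u)"
    and act_bracket: "X \<in> sl2hat \<Longrightarrow> Y \<in> sl2hat \<Longrightarrow>
      act (bracket X Y) u = act X (act Y u) - act Y (act X u)"

locale irreducible_sl2hat_module = sl2hat_module smul act
  for smul :: "complex \<Rightarrow> 'v \<Rightarrow> 'v::ab_group_add" and act :: "affine \<Rightarrow> 'v \<Rightarrow> 'v" +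
  assumes nontrivial: "\<exists>u :: 'v. u \<noteq> 0"
    and irreducible: "subspace W \<Longrightarrow> (\<And>X u. X \<in> sl2hat \<Longrightarrow> u \<in> W \<Longrightarrow> act X u \<in> W)
      \<Longrightarrow> W = {0} \<or> W = UNIV"

text \<open>The irreducible module \<open>L(mu)\<close>, realised on the whole type \<open>'v\<close>, together with a highest
  weight vector; these data are unique up to isomorphism. That \<open>hwv\<close> generates the module is
  part of irreducibility.\<close>

locale irreducible_highest_weight_module = irreducible_sl2hat_module smul act
  for smul :: "complex \<Rightarrow> 'v \<Rightarrow> 'v::ab_group_add" and act :: "affine \<Rightarrow> 'v \<Rightarrow> 'v" +
  fixes mu :: "affine \<Rightarrow> complex" and hwv :: 'v
  assumes hwv_nonzero: "hwv \<noteq> 0"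
    and hwv_weight: "H \<in> cartan \<Longrightarrow> act H hwv = smul (mu H) hwv"
    and hwv_e0: "act chev_e0 hwv = 0"
    and hwv_e1: "act chev_e1 hwv = 0"

definition divided_power ::
  "(complex \<Rightarrow> 'v \<Rightarrow> 'v) \<Rightarrow> (affine \<Rightarrow> 'v \<Rightarrow> 'v) \<Rightarrow> affine \<Rightarrow> nat \<Rightarrow> 'v \<Rightarrow> 'v" where
  "divided_power smul act X p u = smul (1 / fact p) ((act X ^^ p) u)"

definition w_vec ::
  "(complex \<Rightarrow> 'v \<Rightarrow> 'v) \<Rightarrow> (affine \<Rightarrow> 'v \<Rightarrow> 'v) \<Rightarrow> 'v \<Rightarrow> nat \<Rightarrow> 'v" where
  "w_vec smul act v n = divided_power smul act (loop mat_x (- int (n div 2))) (n div 2) v"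

text \<open>Parts are indexed from 0: the part usually written with index \<open>i + 1\<close> is \<open>lam i\<close>.\<close>

definition is_partition :: "(nat \<Rightarrow> nat) \<Rightarrow> bool" where
  "is_partition lam \<longleftrightarrow> antimono lam \<and> finite {i. lam i \<noteq> 0}"

definition psize :: "(nat \<Rightarrow> nat) \<Rightarrow> nat" where
  "psize lam = (\<Sum>i | lam i \<noteq> 0. lam i)"

definition psupp :: "(nat \<Rightarrow> nat) \<Rightarrow> nat" where
  "psupp lam = card {i. lam i \<noteq> 0}"

text \<open>Only used for \<open>j \<ge> 1\<close>; the set of zero parts is infinite.\<close>

definition pmult :: "(nat \<Rightarrow> nat) \<Rightarrow> nat \<Rightarrow> nat" where
  "pmult lam j = card {i. lam i = j}"

definition PP :: "nat \<Rightarrow> (nat \<times> nat \<times> (nat \<Rightarrow> nat)) set" where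
  "PP n = {(n', k, lam). n' = n \<and> k \<le> n \<and> is_partition lam \<and> lam 0 \<le> k \<and> psupp lam \<le> n - k}"

definition PP_stab :: "nat \<Rightarrow> (nat \<times> nat \<times> (nat \<Rightarrow> nat)) set" where
  "PP_stab n = {(n', k, lam) \<in> PP n. psize lam \<le> min (n - k) k}"

definition z_coeff :: "nat \<times> nat \<times> (nat \<Rightarrow> nat) \<Rightarrow> complex" where
  "z_coeff xi = (case xi of (n, k, lam) \<Rightarrow>
     (-1) powi (int (n div 4) - int ((n - k) div 2))
       / (fact (n - k - psupp lam) * (\<Prod>j\<in>{1..k}. fact (pmult lam j))))"

text \<open>The operators \<open>y t^m\<close> commute pairwise; the factors are applied with the first index
  outermost.\<close>

definition c_vec ::
  "(complex \<Rightarrow> 'v \<Rightarrow> 'v) \<Rightarrow> (affine \<Rightarrow> 'v \<Rightarrow> 'v) \<Rightarrow> 'v \<Rightarrow> nat \<times> nat \<times> (nat \<Rightarrow> nat) \<Rightarrow> 'v" where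
  "c_vec smul act v xi = (case xi of (n, k, lam) \<Rightarrow>
     smul (z_coeff xi)
       (foldr (\<lambda>i. act (loop mat_y (int k - int (lam i)))) [0..<n - k] (w_vec smul act v n)))"

text \<open>\<open>h \<otimes> t^-1 C[t^-1]\<close> is an abelian subalgebra with basis \<open>h t^-j\<close>, \<open>j \<ge> 1\<close>, so its
  enveloping algebra is the polynomial algebra in these elements. Polynomials are finitely supported
  functions from exponent vectors to coefficients, with the convolution product of
  \<open>Poly_Mapping\<close>; the variable with index \<open>j\<close> is \<open>h t^-j\<close>, and the index 0 is never used.\<close>

type_synonym hpoly = "(nat \<Rightarrow>\<^sub>0 nat) \<Rightarrow>\<^sub>0 complex"

definition hconst :: "complex \<Rightarrow> hpoly" where
  "hconst a = Poly_Mapping.single 0 a"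

definition hvar :: "nat \<Rightarrow> hpoly" where
  "hvar j = Poly_Mapping.single (Poly_Mapping.single j 1) 1"

definition hmonom_act :: "(affine \<Rightarrow> 'v \<Rightarrow> 'v) \<Rightarrow> (nat \<Rightarrow>\<^sub>0 nat) \<Rightarrow> 'v \<Rightarrow> 'v" where
  "hmonom_act act e =
     foldr (\<lambda>j. act (loop mat_h (- int j)) ^^ Poly_Mapping.lookup e j)
       (sorted_list_of_set (Poly_Mapping.keys e))"

definition hpoly_act ::
  "(complex \<Rightarrow> 'v \<Rightarrow> 'v::ab_group_add) \<Rightarrow> (affine \<Rightarrow> 'v \<Rightarrow> 'v) \<Rightarrow> hpoly \<Rightarrow> 'v \<Rightarrow> 'v" where
  "hpoly_act smul act P u =
     (\<Sum>e\<in>Poly_Mapping.keys P. smul (Poly_Mapping.lookup P e) (hmonom_act act e u))"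

text \<open>Since parts are indexed from 0, the set partitions are those of \<open>{..<r}\<close>.\<close>

definition set_partitions_of_type :: "nat \<Rightarrow> (nat \<Rightarrow> nat) \<Rightarrow> nat set set set" where
  "set_partitions_of_type r \<pi> =
     {B. partition_on {..<r} B \<and>
         (\<exists>\<beta>. bij_betw \<beta> {..<psupp \<pi>} B \<and> (\<forall>i<psupp \<pi>. card (\<beta> i) = \<pi> i))}"

definition H_poly :: "(nat \<Rightarrow> nat) \<Rightarrow> (nat \<Rightarrow> nat) \<Rightarrow> hpoly" where
  "H_poly \<pi> lam =
     (\<Sum>B\<in>set_partitions_of_type (psupp lam) \<pi>. \<Prod>b\<in>B. hvar (\<Sum>j\<in>b. lam j))"

definition C'_coeff :: "(nat \<Rightarrow> nat) \<Rightarrow> complex" where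
  "C'_coeff \<pi> = (\<Prod>i<psupp \<pi>. fact (\<pi> i - 1))"

text \<open>No part of \<open>lam\<close> exceeds \<open>lam 0\<close>, so the product of the factorials of the multiplicities
  stops there.\<close>

definition f_poly :: "(nat \<Rightarrow> nat) \<Rightarrow> hpoly" where
  "f_poly lam =
     (if psupp lam = 0 then 1
      else hconst ((-1) ^ psupp lam / (\<Prod>j\<in>{1..lam 0}. fact (pmult lam j)))
        * (\<Sum>\<pi> | is_partition \<pi> \<and> psize \<pi> = psupp lam. hconst (C'_coeff \<pi>) * H_poly \<pi> lam))"

lemma finite_partitions: "finite {\<pi>. is_partition \<pi> \<and> psize \<pi> = r}"
proof -
  have "{\<pi>. is_partition \<pi> \<and> psize \<pi> = r}
      \<subseteq> {\<pi>. \<forall>i. (i \<in> {..<r} \<longrightarrow> \<pi> i \<in> {..r}) \<and> (i \<notin> {..<r} \<longrightarrow> \<pi> i = 0)}"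
  proof (intro subsetI CollectI allI conjI impI)
    fix \<pi> i assume "\<pi> \<in> {\<pi>. is_partition \<pi> \<and> psize \<pi> = r}"
    then have \<pi>: "is_partition \<pi>" and r: "psize \<pi> = r" by auto
    have fin: "finite {i. \<pi> i \<noteq> 0}" and anti: "antimono \<pi>"
      using \<pi> by (auto simp: is_partition_def)
    show "\<pi> i \<in> {..r}"
      using r fin member_le_sum[of i "{i. \<pi> i \<noteq> 0}" \<pi>] by (cases "\<pi> i = 0") (auto simp: psize_def)
    show "\<pi> i = 0" if i: "i \<notin> {..<r}"
    proof (rule ccontr)
      assume "\<pi> i \<noteq> 0"
      then have "\<pi> j \<noteq> 0" if "j \<le> i" for j
        using antimonoD[OF anti that] by simp
      then have "{..i} \<subseteq> {i. \<pi> i \<noteq> 0}" by auto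
      then have "Suc i \<le> card {i. \<pi> i \<noteq> 0}"
        using card_mono[OF fin, of "{..i}"] by simp
      also have "\<dots> = (\<Sum>j | \<pi> j \<noteq> 0. 1)" by (rule card_eq_sum)
      also have "\<dots> \<le> psize \<pi>"
        unfolding psize_def by (rule sum_mono) auto
      finally show False using i r by simp
    qed
  qed
  then show ?thesis
    by (rule finite_subset) (rule finite_set_of_finite_funs, auto)
qed

lemma finite_set_partitions_of_type: "finite (set_partitions_of_type r \<pi>)"
  by (rule finite_subset[of _ "Pow (Pow {..<r})"])
    (auto simp: set_partitions_of_type_def partition_on_def)

end

theory Submission
  imports Defs
begin

text \<open>Put \<open>N = n / 2\<close>. The operators \<open>e a = y t^(N-a)\<close>, \<open>f b = x t^(-N-b)\<close> and
  \<open>h c = - h t^(-c)\<close>, with \<open>N c\<close> added to \<open>h 0\<close>, satisfy the relations of the current algebra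
  \<open>sl2[s]\<close>, and \<open>e a\<close> kills the highest weight vector for \<open>a \<le> N\<close>. Commuting the \<open>e\<close>'s through
  \<open>f 0 ^ N\<close> gives \<open>N!\<close> times the augmented monomial symmetric function of \<open>lam\<close> in which the power
  sum of degree \<open>d\<close> is replaced by \<open>h d\<close>. Expanding augmented monomials in power sums over set
  partitions (Moebius inversion) gives \<open>f_lambda\<close>; the sign \<open>(-1)^r\<close> collects the signs of the
  Moebius function and of \<open>h d\<close>. Irreducibility enters only through \<open>y v = 0\<close>.\<close>

section \<open>Augmented monomials and the current algebra\<close>

text \<open>The central charge enters as the power sum of degree 0. The cocycle survives in the
  bracket of \<open>e a\<close> and \<open>f b\<close> only for \<open>a = b = 0\<close>, with
  coefficient \<open>N\<close>. On the highest weight vector, of level 1 and killed by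
  \<open>h\<close>, the operator \<open>h 0\<close> is therefore multiplication by \<open>N\<close>,
  the number of factors in \<open>f 0 ^ N\<close>. A power sum of degree 0 has to be the number of
  variables, so the operators imitate power sums in \<open>N\<close> variables, one for each
  \<open>f 0\<close>. The zero parts of \<open>lam\<close> pick the variables left over, and the
  resulting \<open>(N - r)!\<close> cancels the \<open>m_0!\<close> of \<open>z_coeff\<close>, as
  \<open>N!\<close> cancels the divided power.

  The obstacle is that an \<open>h\<close> created by an \<open>e\<close> still has to pass other
  operators. Passing an \<open>f\<close>, it raises the degree of that \<open>f\<close>, so the
  induction cannot stay with \<open>f 0 ^ N\<close>: it runs over products of \<open>f\<close>'s of
  arbitrary degrees, and \<open>match_sum\<close> records the exponent lists that such a product
  yields. Passing an \<open>e\<close>, it raises the degree of that \<open>e\<close>, which is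
  harmless while the total degree stays at most \<open>N\<close>.\<close>

text \<open>The sum of \<open>G\<close> over all lists obtained by adding to the entries of \<open>\<mu>\<close> the weights
  \<open>b j\<close> along a bijection with \<open>J\<close>.\<close>

fun match_sum :: "nat list \<Rightarrow> 'i set \<Rightarrow> ('i \<Rightarrow> nat) \<Rightarrow> (nat list \<Rightarrow> 'v) \<Rightarrow> 'v::ab_group_add" where
  "match_sum [] J b G = G []"
| "match_sum (a # \<mu>) J b G = (\<Sum>i\<in>J. match_sum \<mu> (J - {i}) b (\<lambda>c. G ((a + b i) # c)))"

lemma match_sum_cong:
  fixes G :: "nat list \<Rightarrow> 'v::ab_group_add"
  assumes "\<And>j. j \<in> J \<Longrightarrow> b j = b' j"
  shows "match_sum \<mu> J b G = match_sum \<mu> J b' G"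
  using assms
proof (induction \<mu> arbitrary: J G)
  case (Cons a \<mu>)
  have "match_sum \<mu> (J - {i}) b G' = match_sum \<mu> (J - {i}) b' G'"
    for i and G' :: "nat list \<Rightarrow> 'v"
    by (rule Cons.IH) (use Cons.prems in auto)
  then show ?case using Cons.prems by simp
qed simp

lemma match_sum_add:
  "match_sum \<mu> J b (\<lambda>c. G c + G' c) = match_sum \<mu> J b G + match_sum \<mu> J b G'"
  by (induction \<mu> arbitrary: J G G') (simp_all add: sum.distrib)

lemma match_sum_diff:
  "match_sum \<mu> J b (\<lambda>c. G c - G' c) = match_sum \<mu> J b G - match_sum \<mu> J b G'"
  by (induction \<mu> arbitrary: J G G') (simp_all add: sum_subtractf)

text \<open>As \<open>J\<close> has as many elements as \<open>\<mu>\<close>, every matching uses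
  each \<open>j\<close> exactly once. Raising the weight of \<open>j\<close> thus raises exactly one
  entry of the resulting list, and summing over \<open>j\<close> runs through all entries.\<close>

lemma match_sum_shift:
  assumes "finite J" "card J = length \<mu>"
  shows "(\<Sum>j\<in>J. match_sum \<mu> J (b(j := b j + d)) G)
    = match_sum \<mu> J b (\<lambda>c. \<Sum>k<length c. G (c[k := c ! k + d]))"
  using assms
proof (induction \<mu> arbitrary: J G)
  case Nil
  then show ?case by simp
next
  case (Cons a \<mu>)
  let ?b = "\<lambda>j. b(j := b j + d)"
  have "(\<Sum>j\<in>J. match_sum (a # \<mu>) J (?b j) G)
      = (\<Sum>i\<in>J. \<Sum>j\<in>J. match_sum \<mu> (J - {i}) (?b j) (\<lambda>c. G ((a + ?b j i) # c)))"
    unfolding match_sum.simps by (rule sum.swap)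
  also have "\<dots> = (\<Sum>i\<in>J. match_sum \<mu> (J - {i}) b
      (\<lambda>c. \<Sum>k<length ((a + b i) # c). G (((a + b i) # c)[k := ((a + b i) # c) ! k + d])))"
  proof (rule sum.cong[OF refl])
    fix i assume i: "i \<in> J"
    have "(\<Sum>j\<in>J. match_sum \<mu> (J - {i}) (?b j) (\<lambda>c. G ((a + ?b j i) # c)))
        = match_sum \<mu> (J - {i}) (?b i) (\<lambda>c. G ((a + ?b i i) # c))
          + (\<Sum>j\<in>J - {i}. match_sum \<mu> (J - {i}) (?b j) (\<lambda>c. G ((a + ?b j i) # c)))"
      using i Cons.prems(1) by (rule sum.remove[rotated])
    also have "match_sum \<mu> (J - {i}) (?b i) (\<lambda>c. G ((a + ?b i i) # c))
        = match_sum \<mu> (J - {i}) b (\<lambda>c. G ((a + b i + d) # c))"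
      by (subst match_sum_cong[where b' = b]) (auto simp: ac_simps)
    also have "(\<Sum>j\<in>J - {i}. match_sum \<mu> (J - {i}) (?b j) (\<lambda>c. G ((a + ?b j i) # c)))
        = (\<Sum>j\<in>J - {i}. match_sum \<mu> (J - {i}) (?b j) (\<lambda>c. G ((a + b i) # c)))"
      by (rule sum.cong) auto
    also have "\<dots> = match_sum \<mu> (J - {i}) b
        (\<lambda>c. \<Sum>k<length c. G ((a + b i) # c[k := c ! k + d]))"
      by (rule Cons.IH) (use Cons.prems i in auto)
    finally show "(\<Sum>j\<in>J. match_sum \<mu> (J - {i}) (?b j) (\<lambda>c. G ((a + ?b j i) # c)))
      = match_sum \<mu> (J - {i}) b
      (\<lambda>c. \<Sum>k<length ((a + b i) # c). G (((a + b i) # c)[k := ((a + b i) # c) ! k + d]))"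
      by (simp add: sum.lessThan_Suc_shift match_sum_add del: sum.lessThan_Suc fun_upd_apply)
  qed
  finally show ?case unfolding match_sum.simps .
qed

text \<open>For commuting \<open>p d\<close> this is the action of the augmented monomial symmetric function, the sum
  over all tuples of distinct variables of the monomial with exponent list \<open>c\<close>, with \<open>p d\<close> for the
  power sum of degree \<open>d\<close>: multiplying by \<open>p d\<close> either uses a new variable or repeats one.\<close>

function aug_monomial :: "(nat \<Rightarrow> 'v \<Rightarrow> 'v) \<Rightarrow> nat list \<Rightarrow> 'v \<Rightarrow> 'v::ab_group_add" where
  "aug_monomial p [] u = u"
| "aug_monomial p (d # c) u =
    aug_monomial p c (p d u) - (\<Sum>k<length c. aug_monomial p (c[k := c ! k + d]) u)"
  by pat_completeness auto
termination by (relation "Wellfounded.measure (\<lambda>(p, c, u). length c)") auto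

text \<open>The operators stand for \<open>e s^a\<close>, \<open>f s^a\<close>, \<open>h s^a\<close>
  in \<open>sl2[s]\<close>. Twice a vector is written as a sum because \<open>'v\<close> is only an
  abelian group here.\<close>

locale current_sl2 =
  fixes e f h :: "nat \<Rightarrow> 'v \<Rightarrow> 'v::ab_group_add"
  assumes add_e: "Modules.additive (e a)" and add_f: "Modules.additive (f a)" and add_h: "Modules.additive (h a)"
    and f_f: "f a (f b u) = f b (f a u)"
    and e_f: "e a (f b u) = f b (e a u) + h (a + b) u"
    and h_f: "h a (f b u) = f b (h a u) - (f (a + b) u + f (a + b) u)"
    and e_h: "e a (h b u) = h b (e a u) - (e (a + b) u + e (a + b) u)"
begin

text \<open>The factors commute, so a set can index them. This gives direct access to the symmetry
  between two factors and to the removal of any one of them.\<close>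

definition f_prod :: "('i \<Rightarrow> nat) \<Rightarrow> 'i set \<Rightarrow> 'v \<Rightarrow> 'v" where
  "f_prod b J u = Finite_Set.fold (\<lambda>j. f (b j)) u J"

sublocale F: comp_fun_commute "\<lambda>j. f (b j)" for b :: "'i \<Rightarrow> nat"
  by unfold_locales (auto simp: fun_eq_iff f_f)

lemma f_prod_simps:
  "f_prod b {} u = u"
  "finite J \<Longrightarrow> x \<notin> J \<Longrightarrow> f_prod b (insert x J) u = f (b x) (f_prod b J u)"
  by (simp_all add: f_prod_def F.fold_insert)

lemma f_prod_remove:
  "finite J \<Longrightarrow> x \<in> J \<Longrightarrow> f_prod b J u = f (b x) (f_prod b (J - {x}) u)"
  by (simp add: f_prod_def F.fold_rec)

lemma f_prod_cong:
  assumes "\<And>j. j \<in> J \<Longrightarrow> b j = b' j"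
  shows "f_prod b J u = f_prod b' J u"
proof (cases "finite J")
  case True
  then show ?thesis using assms
    by (induction J rule: finite_induct) (auto simp: f_prod_simps)
qed (simp add: f_prod_def)

lemma h_f_prod:
  assumes "finite J"
  shows "h c (f_prod b J u) = f_prod b J (h c u)
    - (\<Sum>j\<in>J. f_prod (b(j := b j + c)) J u + f_prod (b(j := b j + c)) J u)"
  using assms
proof (induction J rule: finite_induct)
  case empty
  then show ?case by (simp add: f_prod_simps)
next
  case (insert x J)
  define g where "g j = b(j := b j + c)" for j
  have *: "f (b x) (f_prod (g j) J u) = f_prod (g j) (insert x J) u"
    if "j \<in> J" for j
    using insert that by (auto simp: f_prod_simps g_def)
  have **: "f (c + b x) (f_prod b J u) = f_prod (g x) (insert x J) u"
  proof -
    have "f_prod b J u = f_prod (g x) J u"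
      using insert by (intro f_prod_cong) (auto simp: g_def)
    then show ?thesis using insert by (simp add: f_prod_simps g_def ac_simps)
  qed
  show ?case
    using insert unfolding g_def [symmetric]
    by (simp add: f_prod_simps(2)[of J x b] h_f Modules.additive.diff[OF add_f]
        Modules.additive.add[OF add_f] Modules.additive.sum[OF add_f] * **)
qed

text \<open>Each \<open>f (b i)\<close> met by \<open>e a\<close> turns into
  \<open>h (a + b i)\<close>, which moves right and shifts every later factor with coefficient -2.
  The shifted product is symmetric in the two indices involved, so the 2 splits into one term for
  each ordered pair. The coefficient 1 thus obtained is that of the recursion for
  \<open>aug_monomial\<close>.\<close>

lemma e_f_prod:
  assumes "finite J" "e a u = 0"
  shows "e a (f_prod b J u) = (\<Sum>i\<in>J. f_prod b (J - {i}) (h (a + b i) u)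
    - (\<Sum>j\<in>J - {i}. f_prod (b(j := b j + (a + b i))) (J - {i}) u))"
  using assms(1)
proof (induction J rule: finite_induct)
  case empty
  then show ?case by (simp add: f_prod_simps assms)
next
  case (insert x J)
  let ?J = "insert x J"
  define g where "g i j = b(j := b j + (a + b i))" for i j
  note IH = insert.IH[folded g_def]
  have x: "?J - {x} = J" using insert by auto
  have 1: "f_prod b (?J - {i}) (h (a + b i) u) = f (b x) (f_prod b (J - {i}) (h (a + b i) u))"
    if "i \<in> J" for i
  proof -
    have "?J - {i} = insert x (J - {i})" using insert that by auto
    then show ?thesis using insert by (simp add: f_prod_simps)
  qed
  have 2: "(\<Sum>j\<in>?J - {i}. f_prod (g i j) (?J - {i}) u)
      = f_prod (g x i) J u + (\<Sum>j\<in>J - {i}. f (b x) (f_prod (g i j) (J - {i}) u))"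
    if i: "i \<in> J" for i
  proof -
    have J: "?J - {i} = insert x (J - {i})" using insert that by auto
    have "f_prod (g i x) (J - {i}) u = f_prod (g x i) (J - {i}) u"
      using insert i by (intro f_prod_cong) (auto simp: g_def)
    \<comment> \<open>Merging \<open>i\<close> into \<open>x\<close> or \<open>x\<close> into
      \<open>i\<close> gives the same factor, of degree \<open>a + b x + b i\<close>.\<close>
    then have "f_prod (g i x) (?J - {i}) u = f_prod (g x i) J u"
      using insert i by (simp add: J f_prod_simps f_prod_remove[of J i]) (simp add: g_def ac_simps)
    moreover have "f_prod (g i j) (?J - {i}) u = f (b x) (f_prod (g i j) (J - {i}) u)"
      if "j \<in> J - {i}" for j
    proof -
      have "g i j x = b x" using insert that by (auto simp: g_def)
      then show ?thesis using insert by (simp add: J f_prod_simps)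
    qed
    ultimately show ?thesis
      using insert by (simp add: J)
  qed
  have "e a (f_prod b ?J u) = f (b x) (e a (f_prod b J u)) + h (a + b x) (f_prod b J u)"
    using insert by (simp add: f_prod_simps e_f)
  also have "\<dots> = (f_prod b (?J - {x}) (h (a + b x) u) - (\<Sum>j\<in>?J - {x}. f_prod (g x j) (?J - {x}) u))
    + (\<Sum>i\<in>J. f_prod b (?J - {i}) (h (a + b i) u) - (\<Sum>j\<in>?J - {i}. f_prod (g i j) (?J - {i}) u))"
    unfolding x IH using h_f_prod[OF insert.hyps(1), of "a + b x" b u, folded g_def]
    by (simp add: 1 2 Modules.additive.sum[OF add_f] Modules.additive.diff[OF add_f]
        sum_subtractf sum.distrib)
  also have "\<dots> = (\<Sum>i\<in>?J. f_prod b (?J - {i}) (h (a + b i) u)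
    - (\<Sum>j\<in>?J - {i}. f_prod (g i j) (?J - {i}) u))"
    using insert by simp
  finally show ?case unfolding g_def .
qed

lemma additive_fold_e: "Modules.additive (fold e \<mu>)"
  by (induction \<mu>) (auto simp: Modules.additive_def Modules.additive.add[OF add_e])

text \<open>The bound \<open>K\<close> is what the stability hypothesis is for: only finitely many of the \<open>e a\<close>
  annihilate the highest weight vector.\<close>

lemma e_prod_f_prod:
  fixes J :: "'i set"
  assumes "finite J" "card J = length \<mu>" "sum_list \<mu> + sum b J \<le> K"
    and "\<And>a. a \<le> K \<Longrightarrow> e a u = 0"
  shows "fold e \<mu> (f_prod b J u) = match_sum \<mu> J b (\<lambda>c. aug_monomial h c u)"
  using assms
proof (induction \<mu> arbitrary: J b K u)
  case Nil
  then show ?case by (simp add: f_prod_simps)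
next
  case (Cons a \<mu>)
  let ?b = "\<lambda>i j. b(j := b j + (a + b i))"
  have a: "e a u = 0" using Cons.prems by auto
  have S: "sum b J = b i + sum b (J - {i})" if "i \<in> J" for i
    using Cons.prems(1) that by (rule sum.remove)
  \<comment> \<open>Commuting \<open>e a'\<close> past \<open>h (a + b i)\<close> produces
    \<open>e (a' + a + b i)\<close>, so the new vector is annihilated only up to a smaller bound.
    The total degree of what remains drops by the same amount.\<close>
  have 1: "fold e \<mu> (f_prod b (J - {i}) (h (a + b i) u))
      = match_sum \<mu> (J - {i}) b (\<lambda>c. aug_monomial h c (h (a + b i) u))" if i: "i \<in> J" for i
  proof (rule Cons.IH[of _ _ "K - (a + b i)"])
    fix a' assume "a' \<le> K - (a + b i)"
    moreover have "a + b i \<le> K" using Cons.prems(3) S[OF i] by simp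
    ultimately show "e a' (h (a + b i) u) = 0"
      by (simp add: e_h Cons.prems(4) Modules.additive.zero[OF add_h])
  qed (use Cons.prems S[OF i] i in auto)
  have 2: "fold e \<mu> (f_prod (?b i j) (J - {i}) u)
      = match_sum \<mu> (J - {i}) (?b i j) (\<lambda>c. aug_monomial h c u)"
    if i: "i \<in> J" and j: "j \<in> J - {i}" for i j
  proof (rule Cons.IH[of _ _ K])
    \<comment> \<open>Merging moves the degrees \<open>a\<close> and \<open>b i\<close> onto
      \<open>j\<close>, so the total degree is unchanged and the bound \<open>K\<close> can
      stay.\<close>
    have "sum (?b i j) (J - {i}) = (b j + (a + b i)) + sum (?b i j) (J - {i} - {j})"
      using Cons.prems(1) j by (subst sum.remove[of _ j]) auto
    also have "sum (?b i j) (J - {i} - {j}) = sum b (J - {i} - {j})"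
      by (rule sum.cong) auto
    also have "b j + (a + b i) + \<dots> = a + b i + sum b (J - {i})"
      using Cons.prems(1) j by (subst sum.remove[of "J - {i}" j]) auto
    finally show "sum_list \<mu> + sum (?b i j) (J - {i}) \<le> K"
      using Cons.prems(3) S[OF i] by simp
  qed (use Cons.prems i in auto)
  have "fold e (a # \<mu>) (f_prod b J u) = fold e \<mu> (e a (f_prod b J u))" by simp
  also have "\<dots> = (\<Sum>i\<in>J. match_sum \<mu> (J - {i}) b (\<lambda>c. aug_monomial h c (h (a + b i) u))
     - (\<Sum>j\<in>J - {i}. match_sum \<mu> (J - {i}) (?b i j) (\<lambda>c. aug_monomial h c u)))"
    unfolding e_f_prod[OF Cons.prems(1) a]
    by (simp add: Modules.additive.sum[OF additive_fold_e] Modules.additive.diff[OF additive_fold_e] 1 2)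
  \<comment> \<open>\<open>match_sum_shift\<close> turns the merged terms into the subtracted sum in
    the recursion of \<open>aug_monomial\<close> for the new head \<open>a + b i\<close>.\<close>
  also have "\<dots> = match_sum (a # \<mu>) J b (\<lambda>c. aug_monomial h c u)"
    using Cons.prems(1,2) by (simp add: match_sum_shift match_sum_diff)
  finally show ?case .
qed

end

text \<open>With zero weights every matching returns \<open>\<mu>\<close> itself, so only the number
  of bijections remains.\<close>

lemma (in vector_space) match_sum_0:
  assumes "finite J" "card J = length \<mu>"
  shows "match_sum \<mu> J (\<lambda>_. 0) G = scale (of_nat (fact (length \<mu>))) (G \<mu>)"
  using assms
proof (induction \<mu> arbitrary: J G)
  case (Cons a \<mu>)
  then have "match_sum (a # \<mu>) J (\<lambda>_. 0) G
      = (\<Sum>i\<in>J. scale (of_nat (fact (length \<mu>))) (G (a # \<mu>)))"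
    by (auto intro!: sum.cong)
  also have "\<dots> = scale (of_nat (fact (length (a # \<mu>)))) (G (a # \<mu>))"
    using Cons.prems by (simp add: sum_constant_scale algebra_simps)
  finally show ?case .
qed simp

lemma (in vector_space) aug_monomial_scale:
  assumes "\<And>c w. p c (scale z w) = scale z (p c w)"
  shows "aug_monomial p c (scale z w) = scale z (aug_monomial p c w)"
  using assms
proof (induction p c w rule: aug_monomial.induct)
  case (2 p d c u)
  have "aug_monomial p c (scale z (p d u)) = scale z (aug_monomial p c (p d u))"
    using 2 by blast
  moreover have "aug_monomial p (c[k := c ! k + d]) (scale z u)
      = scale z (aug_monomial p (c[k := c ! k + d]) u)" if "k < length c" for k
    using 2 that by blast
  ultimately show ?case
    by (simp add: "2.prems" scale_right_diff_distrib scale_sum_right)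
qed simp

lemma (in vector_space) aug_monomial_zeros:
  assumes "\<And>c z w. p c (scale z w) = scale z (p c w)" "p 0 u = scale (of_nat (m + length c)) u"
  shows "aug_monomial p (replicate m 0 @ c) u = scale (of_nat (fact m)) (aug_monomial p c u)"
proof -
  have "aug_monomial p (replicate k 0 @ c) u
      = scale (\<Prod>i<k. of_nat (m + length c) - of_nat (i + length c)) (aug_monomial p c u)" for k
  proof (induction k)
    case (Suc k)
    have "aug_monomial p (replicate (Suc k) 0 @ c) u
      = aug_monomial p (replicate k 0 @ c) (scale (of_nat (m + length c)) u)
        - (\<Sum>i<k + length c. aug_monomial p (replicate k 0 @ c) u)"
      using assms(2) by simp
    also have "\<dots> = scale (of_nat (m + length c) - of_nat (k + length c))
        (aug_monomial p (replicate k 0 @ c) u)"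
      by (simp only: aug_monomial_scale[of p, OF assms(1)] sum_constant_scale card_lessThan
          scale_left_diff_distrib)
    finally show ?case by (simp add: Suc mult.commute)
  qed simp
  moreover have "(\<Prod>i<m. of_nat (m + length c) - of_nat (i + length c)) = (of_nat (fact m) :: 'a)"
  proof -
    have "(\<Prod>i<m. of_nat (m + length c) - of_nat (i + length c)) = (\<Prod>i<m. of_nat (m - i) :: 'a)"
      by (intro prod.cong) (auto simp: of_nat_diff)
    also have "\<dots> = of_nat (\<Prod>i<m. m - i)" by simp
    also have "(\<Prod>i<m. m - i) = fact m"
      by (simp add: fact_prod_rev atLeast0LessThan)
    finally show ?thesis .
  qed
  ultimately show ?thesis by simp
qed

section \<open>Sums over set partitions\<close>

text \<open>The Moebius function of the partition lattice contributes
  \<open>(-1) ^ (card \<beta> - 1) * fact (card \<beta> - 1)\<close> for each block. The extra sign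
  per block is there because \<open>p\<close> will be minus the power sum.\<close>

definition partition_sum ::
  "(nat \<Rightarrow> 'a::comm_ring_1) \<Rightarrow> 'i set \<Rightarrow> ('i \<Rightarrow> nat) \<Rightarrow> 'a" where
  "partition_sum p I c =
    (\<Sum>B | partition_on I B. \<Prod>\<beta>\<in>B. (-1) ^ card \<beta> * of_nat (fact (card \<beta> - 1)) * p (sum c \<beta>))"

lemma partition_sum_empty: "partition_sum p {} c = 1"
  by (simp add: partition_sum_def partition_on_empty)

text \<open>The new point joins a block \<open>\<beta>\<close> or forms a block of its own. The
  choice \<open>\<beta> = {}\<close> encodes the second case: the empty set is never a block, so
  removing it changes nothing.\<close>

lemma bij_betw_partition_on_insert:
  assumes "x \<notin> I"
  shows "bij_betw (\<lambda>(B, \<beta>). insert (insert x \<beta>) (B - {\<beta>}))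
    (SIGMA B:{B. partition_on I B}. insert {} B) {B. partition_on (insert x I) B}"
    (is "bij_betw ?\<Phi> ?S ?T")
proof (rule bij_betwI')
  fix s t assume s: "s \<in> ?S" and t: "t \<in> ?S"
  obtain B \<beta> B' \<beta>' where st: "s = (B, \<beta>)" "t = (B', \<beta>')" by force
  have nx: "x \<notin> \<gamma>" if "\<gamma> \<in> insert {} B \<union> insert {} B'" for \<gamma>
    using s t assms that unfolding st partition_on_def by auto
  have ne: "{} \<notin> B" "{} \<notin> B'"
    using s t by (auto simp: st partition_on_def)
  show "?\<Phi> s = ?\<Phi> t \<longleftrightarrow> s = t"
  proof
    assume eq: "?\<Phi> s = ?\<Phi> t"
    have mem: "\<beta> \<in> insert {} B" "\<beta>' \<in> insert {} B'" using s t by (auto simp: st)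
    have "insert x \<beta> \<in> insert (insert x \<beta>') (B' - {\<beta>'})" using eq by (auto simp: st)
    then have "insert x \<beta> = insert x \<beta>'" using nx by blast
    then have \<beta>: "\<beta> = \<beta>'" using nx[of \<beta>] nx[of \<beta>'] mem by (auto simp: insert_ident)
    have "insert x \<beta> \<notin> B" "insert x \<beta> \<notin> B'" using nx by blast+
    then have "B - {\<beta>} = B' - {\<beta>}" using eq by (auto simp: st \<beta> insert_ident)
    moreover have "\<beta> \<in> B \<longleftrightarrow> \<beta> \<in> B'" using mem ne \<beta> by auto
    ultimately show "s = t" using \<beta> by (auto simp: st)
  qed simp
next
  fix s assume s: "s \<in> ?S"
  obtain B \<beta> where st: "s = (B, \<beta>)" by force
  have B: "partition_on I B" "\<beta> \<in> insert {} B" using s by (auto simp: st)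
  have "partition_on (insert x I) (insert (insert x \<beta>) (B - {\<beta>}))"
  proof (rule partition_onI)
    show "\<Union> (insert (insert x \<beta>) (B - {\<beta>})) = insert x I"
      using B unfolding partition_on_def by auto
    fix p q assume "p \<in> insert (insert x \<beta>) (B - {\<beta>})" "q \<in> insert (insert x \<beta>) (B - {\<beta>})" "p \<noteq> q"
    moreover have "disjnt p q" if "p \<in> B" "q \<in> B" "p \<noteq> q" for p q
      using B that by (auto simp: partition_on_def disjoint_def disjnt_def)
    moreover have "x \<notin> p" if "p \<in> B" for p using B assms that by (auto simp: partition_on_def)
    ultimately show "disjnt p q"
      using B(2) by (auto simp: disjnt_iff)
  next
    show "{} \<notin> insert (insert x \<beta>) (B - {\<beta>})"
      using B by (auto simp: partition_on_def)
  qed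
  then show "?\<Phi> s \<in> ?T" by (simp add: st)
next
  fix B' assume "B' \<in> ?T"
  then have B': "partition_on (insert x I) B'" by simp
  then obtain \<gamma> where \<gamma>: "\<gamma> \<in> B'" "x \<in> \<gamma>" by (auto simp: partition_on_def)
  define \<beta> where "\<beta> = \<gamma> - {x}"
  \<comment> \<open>If \<open>{x}\<close> is a block of \<open>B'\<close>, then
    \<open>\<beta>\<close> is empty and must not be added.\<close>
  define B where "B = (B' - {\<gamma>}) \<union> ({\<beta>} - {{}})"
  have dj: "p \<inter> q = {}" if "p \<in> B'" "q \<in> B'" "p \<noteq> q" for p q
    using B' that by (auto simp: partition_on_def disjoint_def)
  have nx: "x \<notin> p" if "p \<in> B' - {\<gamma>}" for p using dj[of p \<gamma>] \<gamma> that by auto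
  have \<beta>: "\<beta> \<in> insert {} B" "insert x \<beta> = \<gamma>" using \<gamma> by (auto simp: B_def \<beta>_def)
  have nb: "\<beta> \<notin> B' - {\<gamma>}"
  proof
    assume "\<beta> \<in> B' - {\<gamma>}"
    then have "\<beta> = {}" using dj[of \<beta> \<gamma>] \<gamma> by (auto simp: \<beta>_def)
    then show False using \<open>\<beta> \<in> B' - {\<gamma>}\<close> B' by (auto simp: partition_on_def)
  qed
  have "partition_on I B"
  proof (rule partition_onI)
    have "\<Union> B = \<Union> (B' - {\<gamma>}) \<union> (\<gamma> - {x})" by (auto simp: B_def \<beta>_def)
    also have "\<dots> = \<Union> B' - {x}" using nx \<gamma> by auto
    finally show "\<Union> B = I" using B' assms by (auto simp: partition_on_def)
    show "{} \<notin> B" using B' by (auto simp: B_def partition_on_def)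
    fix p q assume "p \<in> B" "q \<in> B" "p \<noteq> q"
    then show "disjnt p q"
      using dj[of p q] dj[of p \<gamma>] dj[of q \<gamma>] \<gamma> by (auto simp: disjnt_def B_def \<beta>_def)
  qed
  moreover have "B' = insert (insert x \<beta>) (B - {\<beta>})"
    using nb \<gamma> unfolding \<beta>(2) by (auto simp: B_def)
  ultimately show "\<exists>s\<in>?S. B' = ?\<Phi> s" using \<beta>(1) by (intro bexI[of _ "(B, \<beta>)"]) auto
qed

text \<open>The singleton block of \<open>x\<close> contributes \<open>- p (c x)\<close>. Putting
  \<open>x\<close> into \<open>\<beta>\<close> multiplies the coefficient of that block by
  \<open>- card \<beta>\<close> and adds \<open>c x\<close> to its exponent; the factor
  \<open>card \<beta>\<close> is a sum over the \<open>j\<close> in \<open>\<beta>\<close> to which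
  \<open>c x\<close> may be added. With \<open>- p\<close> as power sums this is the recursion of
  \<open>aug_monomial\<close>.\<close>

lemma partition_sum_insert:
  assumes "finite I" "x \<notin> I"
  shows "partition_sum p (insert x I) c
    = - p (c x) * partition_sum p I c - (\<Sum>j\<in>I. partition_sum p I (c(j := c j + c x)))"
proof -
  define \<psi> where "\<psi> c \<beta> = (-1) ^ card \<beta> * of_nat (fact (card \<beta> - 1)) * p (sum c \<beta>)"
    for c and \<beta> :: "'a set"
  have P: "partition_sum p J c = (\<Sum>B | partition_on J B. prod (\<psi> c) B)" for J c
    by (simp add: partition_sum_def \<psi>_def)
  let ?\<Phi> = "\<lambda>B \<beta>. insert (insert x \<beta>) (B - {\<beta>})"
  let ?c = "\<lambda>j. c(j := c j + c x)"
  have fin: "finite {B. partition_on I B}"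
    using assms(1) by (rule finitely_many_partition_on)
  have *: "(\<Sum>\<beta>\<in>insert {} B. prod (\<psi> c) (?\<Phi> B \<beta>))
      = - p (c x) * prod (\<psi> c) B - (\<Sum>j\<in>I. prod (\<psi> (?c j)) B)" if B: "partition_on I B" for B
  proof -
    have finB: "finite B" using assms(1) B by (rule finite_elements)
    have U: "I = \<Union> B" and ne: "{} \<notin> B" using B by (auto simp: partition_on_def)
    have dj: "\<beta> \<inter> \<gamma> = {}" if "\<beta> \<in> B" "\<gamma> \<in> B" "\<beta> \<noteq> \<gamma>" for \<beta> \<gamma>
      using B that by (auto simp: partition_on_def disjoint_def)
    have fb: "finite \<beta>" if "\<beta> \<in> B" for \<beta> using that U assms(1) by (auto intro: finite_subset)
    have x: "x \<notin> \<beta>" if "\<beta> \<in> insert {} B" for \<beta> using assms(2) U that by auto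
    have \<Phi>: "prod (\<psi> c) (?\<Phi> B \<beta>) = \<psi> c (insert x \<beta>) * prod (\<psi> c) (B - {\<beta>})"
      if "\<beta> \<in> insert {} B" for \<beta>
      using finB x by (subst prod.insert) auto
    have "prod (\<psi> c) (?\<Phi> B {}) = - p (c x) * prod (\<psi> c) B"
      using ne by (subst \<Phi>) (simp_all add: \<psi>_def)
    moreover have "prod (\<psi> c) (?\<Phi> B \<beta>) = - (\<Sum>j\<in>\<beta>. prod (\<psi> (?c j)) B)" if \<beta>: "\<beta> \<in> B" for \<beta>
    proof -
      have "card \<beta> > 0" using fb[OF \<beta>] \<beta> ne by (auto simp: card_gt_0_iff)
      then obtain k where k: "card \<beta> = Suc k" using gr0_implies_Suc by blast
      have "prod (\<psi> (?c j)) B = (-1) ^ card \<beta> * of_nat (fact (card \<beta> - 1)) * p (sum c (insert x \<beta>))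
          * prod (\<psi> c) (B - {\<beta>})" if j: "j \<in> \<beta>" for j
      proof -
        have "prod (\<psi> (?c j)) B = \<psi> (?c j) \<beta> * prod (\<psi> (?c j)) (B - {\<beta>})"
          using finB \<beta> by (rule prod.remove)
        also have "prod (\<psi> (?c j)) (B - {\<beta>}) = prod (\<psi> c) (B - {\<beta>})"
        proof (rule prod.cong[OF refl])
          fix \<gamma> assume "\<gamma> \<in> B - {\<beta>}"
          then have "j \<notin> \<gamma>" using dj[of \<beta> \<gamma>] \<beta> j by auto
          then have "sum (?c j) \<gamma> = sum c \<gamma>" by (intro sum.cong) auto
          then show "\<psi> (?c j) \<gamma> = \<psi> c \<gamma>" by (simp add: \<psi>_def)
        qed
        also have "sum (?c j) \<beta> = sum c (insert x \<beta>)"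
        proof -
          have "sum (?c j) \<beta> = (c j + c x) + sum (?c j) (\<beta> - {j})"
            using fb[OF \<beta>] j by (subst sum.remove[of _ j]) auto
          also have "sum (?c j) (\<beta> - {j}) = sum c (\<beta> - {j})" by (rule sum.cong) auto
          also have "c j + c x + \<dots> = c x + sum c \<beta>"
            using fb[OF \<beta>] j by (subst (2) sum.remove[of _ j]) auto
          finally show ?thesis using fb[OF \<beta>] x \<beta> by simp
        qed
        then have "\<psi> (?c j) \<beta> = (-1) ^ card \<beta> * of_nat (fact (card \<beta> - 1)) * p (sum c (insert x \<beta>))"
          by (simp add: \<psi>_def)
        finally show ?thesis .
      qed
      then have "(\<Sum>j\<in>\<beta>. prod (\<psi> (?c j)) B) = of_nat (card \<beta>) * ((-1) ^ card \<beta>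
          * of_nat (fact (card \<beta> - 1)) * p (sum c (insert x \<beta>)) * prod (\<psi> c) (B - {\<beta>}))"
        by simp
      also have "\<dots> = - (\<psi> c (insert x \<beta>) * prod (\<psi> c) (B - {\<beta>}))"
        using fb[OF \<beta>] x \<beta> by (simp add: \<psi>_def k fact_Suc of_nat_mult algebra_simps)
      finally show ?thesis using \<Phi> \<beta> by simp
    qed
    moreover have "(\<Sum>j\<in>I. prod (\<psi> (?c j)) B) = (\<Sum>\<beta>\<in>B. \<Sum>j\<in>\<beta>. prod (\<psi> (?c j)) B)"
      unfolding U using fb dj by (subst sum.Union_disjoint) auto
    ultimately show ?thesis
      using finB ne by (simp add: sum_negf)
  qed
  have "partition_sum p (insert x I) c
      = (\<Sum>(B, \<beta>)\<in>(SIGMA B:{B. partition_on I B}. insert {} B). prod (\<psi> c) (?\<Phi> B \<beta>))"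
    unfolding P by (subst sum.reindex_bij_betw[OF bij_betw_partition_on_insert[OF assms(2)], symmetric])
      (simp add: case_prod_unfold)
  also have "\<dots> = (\<Sum>B | partition_on I B. \<Sum>\<beta>\<in>insert {} B. prod (\<psi> c) (?\<Phi> B \<beta>))"
    using fin finite_elements[OF assms(1)] by (subst sum.Sigma) auto
  also have "\<dots> = (\<Sum>B | partition_on I B. - p (c x) * prod (\<psi> c) B - (\<Sum>j\<in>I. prod (\<psi> (?c j)) B))"
    using * by (intro sum.cong) auto
  also have "\<dots> = - p (c x) * partition_sum p I c - (\<Sum>j\<in>I. partition_sum p I (?c j))"
    unfolding P sum_subtractf sum_distrib_left by (subst sum.swap) simp
  finally show ?thesis .
qed

section \<open>Integer partitions as types of set partitions\<close>

lemma is_partition_pos_iff: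
  assumes "is_partition \<pi>"
  shows "0 < \<pi> i \<longleftrightarrow> i < psupp \<pi>"
proof -
  have fin: "finite {i. \<pi> i \<noteq> 0}" and anti: "antimono \<pi>"
    using assms by (auto simp: is_partition_def)
  define s where "s = (LEAST i. \<pi> i = 0)"
  have "\<exists>i. \<pi> i = 0"
  proof (rule ccontr)
    assume "\<nexists>i. \<pi> i = 0"
    then have "{i. \<pi> i \<noteq> 0} = UNIV" by auto
    then show False using fin by simp
  qed
  then have "\<pi> s = 0" unfolding s_def by (rule LeastI_ex)
  then have "\<pi> i = 0" if "i \<ge> s" for i using antimonoD[OF anti that] by simp
  moreover have "\<pi> i \<noteq> 0" if "i < s" for i using that not_less_Least unfolding s_def by blast
  ultimately have *: "\<pi> i \<noteq> 0 \<longleftrightarrow> i < s" for i by (meson not_le)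
  then have "{i. \<pi> i \<noteq> 0} = {..<s}" by auto
  then have "psupp \<pi> = s" by (simp add: psupp_def)
  then show ?thesis using * by simp
qed

lemma psize_eq: "is_partition \<pi> \<Longrightarrow> psize \<pi> = (\<Sum>i<psupp \<pi>. \<pi> i)"
  by (auto simp: psize_def is_partition_pos_iff intro!: sum.cong)

text \<open>Both partitions list the block sizes of \<open>B\<close> in decreasing order, and a
  multiset has only one such listing.\<close>

lemma partition_type_unique:
  assumes "is_partition \<pi>" "is_partition \<pi>'"
    and "bij_betw \<beta> {..<psupp \<pi>} B" "\<forall>i<psupp \<pi>. card (\<beta> i) = \<pi> i"
    and "bij_betw \<beta>' {..<psupp \<pi>'} B" "\<forall>i<psupp \<pi>'. card (\<beta>' i) = \<pi>' i"
  shows "\<pi> = \<pi>'"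
proof -
  have L: "map \<rho> [0..<psupp \<rho>] = rev (sorted_list_of_multiset (image_mset card (mset_set B)))"
    if \<rho>: "is_partition \<rho>" and b: "bij_betw \<gamma> {..<psupp \<rho>} B" "\<forall>i<psupp \<rho>. card (\<gamma> i) = \<rho> i"
    for \<rho> \<gamma>
  proof -
    have "image_mset card (mset_set B) = image_mset card (image_mset \<gamma> (mset_set {..<psupp \<rho>}))"
      using b(1) by (simp add: image_mset_mset_set bij_betw_def)
    also have "\<dots> = image_mset \<rho> (mset_set {..<psupp \<rho>})"
      using b(2) by (auto simp: multiset.map_comp intro!: image_mset_cong)
    also have "\<dots> = mset (map \<rho> [0..<psupp \<rho>])"
      by (simp add: atLeast0LessThan)
    finally have "image_mset card (mset_set B) = mset (rev (map \<rho> [0..<psupp \<rho>]))" by simp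
    moreover have "sorted (rev (map \<rho> [0..<psupp \<rho>]))"
    proof -
      have "sorted_wrt (\<lambda>i j. \<rho> j \<le> \<rho> i) [0..<psupp \<rho>]"
        by (rule sorted_wrt_mono_rel[OF _ sorted_upt])
          (use \<rho> in \<open>auto simp: is_partition_def intro: antimonoD\<close>)
      then show ?thesis by (simp only: sorted_wrt_rev sorted_wrt_map)
    qed
    ultimately have "sorted_list_of_multiset (image_mset card (mset_set B)) = rev (map \<rho> [0..<psupp \<rho>])"
      by (simp only: sorted_list_of_multiset_mset sorted_sort_id)
    then show ?thesis by (simp only: rev_rev_ident)
  qed
  have *: "map \<pi> [0..<psupp \<pi>] = map \<pi>' [0..<psupp \<pi>']"
    using L[OF assms(1,3,4)] L[OF assms(2,5,6)] by simp
  then have s: "psupp \<pi> = psupp \<pi>'"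
    using map_eq_imp_length_eq by fastforce
  show ?thesis
  proof
    fix i show "\<pi> i = \<pi>' i"
    proof (cases "i < psupp \<pi>")
      case True
      then show ?thesis using * s by (auto simp: map_eq_conv)
    next
      case False
      then show ?thesis
        using is_partition_pos_iff[OF assms(1), of i] is_partition_pos_iff[OF assms(2), of i] s by simp
    qed
  qed
qed

lemma partition_type_exists:
  assumes "partition_on {..<r} B"
  obtains \<pi> where "is_partition \<pi>" "psize \<pi> = r" "B \<in> set_partitions_of_type r \<pi>"
proof -
  have fin: "finite B" using assms finite_elements by blast
  have fb: "finite \<beta>" "card \<beta> > 0" if "\<beta> \<in> B" for \<beta>
  proof -
    have "\<beta> \<subseteq> {..<r}" "\<beta> \<noteq> {}" using assms that by (auto simp: partition_on_def)
    then show "finite \<beta>" "card \<beta> > 0" by (auto simp: card_gt_0_iff intro: finite_subset)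
  qed
  obtain xs0 where xs0: "set xs0 = B" "distinct xs0" using fin finite_distinct_list by blast
  define xs where "xs = rev (sort_key card xs0)"
  have xs: "set xs = B" "distinct xs" using xs0 by (auto simp: xs_def)
  have sorted: "sorted (rev (map card xs))" by (simp add: xs_def rev_map)
  define \<pi> where "\<pi> i = (if i < length xs then card (xs ! i) else 0)" for i
  have pos: "0 < \<pi> i \<longleftrightarrow> i < length xs" for i
    using fb(2)[of "xs ! i"] xs(1) nth_mem[of i xs] by (cases "i < length xs") (simp_all add: \<pi>_def)
  have "antimono \<pi>"
  proof (rule antimonoI)
    fix i j :: nat assume "i \<le> j"
    then show "\<pi> j \<le> \<pi> i"
      using sorted_rev_nth_mono[OF sorted, of i j] by (auto simp: \<pi>_def)
  qed
  then have \<pi>: "is_partition \<pi>" by (simp add: is_partition_def pos)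
  have s: "psupp \<pi> = length xs" by (simp add: psupp_def pos)
  have bij: "bij_betw ((!) xs) {..<psupp \<pi>} B"
    using xs s by (simp add: bij_betw_nth)
  have "psize \<pi> = (\<Sum>i<psupp \<pi>. card (xs ! i))"
    using \<pi> by (auto simp: psize_eq s \<pi>_def)
  also have "\<dots> = (\<Sum>\<beta>\<in>B. card \<beta>)" by (rule sum.reindex_bij_betw[OF bij])
  also have "\<dots> = card (\<Union> B)"
    using assms fb by (subst card_Union_disjoint) (auto simp: partition_on_def disjoint_def pairwise_def disjnt_def)
  also have "\<dots> = r" using assms by (simp add: partition_on_def)
  finally have "psize \<pi> = r" .
  moreover have "B \<in> set_partitions_of_type r \<pi>"
    using assms bij s by (auto simp: set_partitions_of_type_def \<pi>_def)
  ultimately show ?thesis using \<pi> that by blast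
qed

lemma hconst_simps:
  "hconst 1 = 1" "hconst (a * b) = hconst a * hconst b" "hconst (a + b) = hconst a + hconst b"
  "hconst 0 = 0" "hconst (- a) = - hconst a"
  by (simp_all add: hconst_def mult_single single_add single_uminus)

lemma hconst_of_nat: "hconst (of_nat k) = of_nat k"
  by (induction k) (simp_all add: hconst_simps)

lemma hconst_prod: "hconst (prod g A) = (\<Prod>i\<in>A. hconst (g i))"
  by (induction A rule: infinite_finite_induct) (simp_all add: hconst_simps)

lemma hconst_neg_one_power: "hconst ((-1) ^ k) = (-1) ^ k"
  by (induction k) (simp_all add: hconst_simps)

text \<open>Every set partition has exactly one type. The block sizes add up to the number of
  points, so the sign is the same for all set partitions, and the factorials depend on the type
  alone.\<close>

lemma partition_sum_by_type:
  "partition_sum hvar {..<psupp lam} lam = (-1) ^ psupp lam *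
    (\<Sum>\<pi> | is_partition \<pi> \<and> psize \<pi> = psupp lam. hconst (C'_coeff \<pi>) * H_poly \<pi> lam)"
proof -
  define r where "r = psupp lam"
  let ?T = "{\<pi>. is_partition \<pi> \<and> psize \<pi> = r}"
  have Un: "{B. partition_on {..<r} B} = (\<Union>\<pi>\<in>?T. set_partitions_of_type r \<pi>)"
    by (auto simp: set_partitions_of_type_def elim!: partition_type_exists)
  have dj: "set_partitions_of_type r \<pi> \<inter> set_partitions_of_type r \<pi>' = {}"
    if "\<pi> \<in> ?T" "\<pi>' \<in> ?T" "\<pi> \<noteq> \<pi>'" for \<pi> \<pi>'
  proof (rule ccontr)
    assume "set_partitions_of_type r \<pi> \<inter> set_partitions_of_type r \<pi>' \<noteq> {}"
    then obtain B where "B \<in> set_partitions_of_type r \<pi>" "B \<in> set_partitions_of_type r \<pi>'"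
      by blast
    then obtain \<beta> \<beta>' where "bij_betw \<beta> {..<psupp \<pi>} B" "\<forall>i<psupp \<pi>. card (\<beta> i) = \<pi> i"
      "bij_betw \<beta>' {..<psupp \<pi>'} B" "\<forall>i<psupp \<pi>'. card (\<beta>' i) = \<pi>' i"
      unfolding set_partitions_of_type_def by blast
    then show False using partition_type_unique that by blast
  qed
  have weight: "(\<Prod>\<beta>\<in>B. (-1) ^ card \<beta> * of_nat (fact (card \<beta> - 1)) * hvar (sum lam \<beta>))
      = (-1) ^ r * (hconst (C'_coeff \<pi>) * (\<Prod>b\<in>B. hvar (\<Sum>j\<in>b. lam j)))"
    if B: "B \<in> set_partitions_of_type r \<pi>" for B \<pi>
  proof -
    obtain \<beta> where P: "partition_on {..<r} B" and \<beta>: "bij_betw \<beta> {..<psupp \<pi>} B"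
        "\<And>i. i < psupp \<pi> \<Longrightarrow> card (\<beta> i) = \<pi> i"
      using B by (auto simp: set_partitions_of_type_def)
    have "(\<Prod>\<beta>\<in>B. (-1) ^ card \<beta> :: hpoly) = (-1) ^ (\<Sum>\<beta>\<in>B. card \<beta>)"
      by (simp add: power_sum)
    also have "(\<Sum>\<beta>\<in>B. card \<beta>) = card (\<Union> B)"
      using P by (subst card_Union_disjoint)
        (auto simp: partition_on_def disjoint_def pairwise_def disjnt_def intro: finite_subset)
    also have "\<dots> = r" using P by (simp add: partition_on_def)
    finally have "(\<Prod>\<beta>\<in>B. (-1) ^ card \<beta> :: hpoly) = (-1) ^ r" .
    moreover have "hconst (C'_coeff \<pi>) = (\<Prod>\<beta>\<in>B. of_nat (fact (card \<beta> - 1)))"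
      unfolding C'_coeff_def using \<beta>(2)
      by (subst prod.reindex_bij_betw[OF \<beta>(1), symmetric])
        (simp add: hconst_prod flip: hconst_of_nat)
    ultimately show ?thesis by (simp add: prod.distrib mult.assoc)
  qed
  have "partition_sum hvar {..<r} lam = (\<Sum>\<pi>\<in>?T. \<Sum>B\<in>set_partitions_of_type r \<pi>.
      \<Prod>\<beta>\<in>B. (-1) ^ card \<beta> * of_nat (fact (card \<beta> - 1)) * hvar (sum lam \<beta>))"
    unfolding partition_sum_def Un using finite_partitions finite_set_partitions_of_type dj
    by (subst sum.UNION_disjoint) auto
  also have "\<dots> = (\<Sum>\<pi>\<in>?T. \<Sum>B\<in>set_partitions_of_type r \<pi>.
      (-1) ^ r * (hconst (C'_coeff \<pi>) * (\<Prod>b\<in>B. hvar (\<Sum>j\<in>b. lam j))))"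
    by (intro sum.cong refl weight)
  also have "\<dots> = (-1) ^ r * (\<Sum>\<pi>\<in>?T. hconst (C'_coeff \<pi>) * H_poly \<pi> lam)"
    by (simp add: H_poly_def sum_distrib_left flip: r_def)
  finally show ?thesis by (simp add: r_def)
qed

lemma f_poly_eq:
  assumes "is_partition lam"
  shows "f_poly lam = hconst (1 / (\<Prod>j\<in>{1..lam 0}. fact (pmult lam j)))
    * partition_sum hvar {..<psupp lam} lam"
proof (cases "psupp lam = 0")
  case True
  \<comment> \<open>The product of factorials is then empty, and the only set partition of the empty
    set contributes 1.\<close>
  then have "lam 0 = 0" using is_partition_pos_iff[OF assms, of 0] by simp
  then show ?thesis using True by (simp add: f_poly_def partition_sum_empty hconst_simps lessThan_0)
next
  case False
  have "hconst ((-1) ^ psupp lam / (\<Prod>j\<in>{1..lam 0}. fact (pmult lam j)))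
      = hconst (1 / (\<Prod>j\<in>{1..lam 0}. fact (pmult lam j))) * (-1) ^ psupp lam"
    by (simp flip: hconst_neg_one_power hconst_simps(2))
  then show ?thesis using False by (simp add: f_poly_def partition_sum_by_type mult.assoc)
qed

section \<open>Modules over the affine Lie algebra\<close>

lemma mat2_simps:
  "commutator mat_x mat_y = mat_h" "commutator mat_y mat_x = mat_scale (-1) mat_h"
  "commutator mat_h mat_x = mat_scale 2 mat_x" "commutator mat_h mat_y = mat_scale (-2) mat_y"
  "commutator mat_y mat_h = mat_scale 2 mat_y" "commutator mat_x mat_h = mat_scale (-2) mat_x"
  "commutator A A = 0"
  "trace (mat_x ** mat_y) = 1" "trace (mat_y ** mat_x) = 1" "trace (mat_h ** mat_h) = 2"
  "trace (mat_h ** mat_x) = 0" "trace (mat_h ** mat_y) = 0" "trace (mat_y ** mat_h) = 0"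
  "trace (mat_x ** mat_h) = 0" "trace (mat_x ** mat_x) = 0" "trace (mat_y ** mat_y) = 0"
  "trace mat_x = 0" "trace mat_y = 0" "trace mat_h = 0"
  by (simp_all add: commutator_def mat_x_def mat_y_def mat_h_def mat_scale_def trace_def
      matrix_matrix_mult_def vec_eq_iff sum_2 forall_2 vector_2)

lemma trace_zero_decomp:
  fixes A :: mat2
  assumes "trace A = 0"
  shows "A = mat_scale (A $ 1 $ 2) mat_x + mat_scale (A $ 2 $ 1) mat_y + mat_scale (A $ 1 $ 1) mat_h"
  using assms
  by (simp add: mat_x_def mat_y_def mat_h_def mat_scale_def trace_def vec_eq_iff sum_2 forall_2
      vector_2 add_eq_0_iff)

lemma trace_sum: "trace (sum f S) = (\<Sum>i\<in>S. trace (f i :: mat2))"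
  by (induction S rule: infinite_finite_induct) (simp_all add: trace_add)

lemma trace_commutator: "trace (commutator A B) = 0"
  by (simp add: commutator_def trace_sub trace_mul_sym[of A B])

lemma trace_mat_scale_1: "trace (mat_scale z A) = z * trace A"
  by (simp add: trace_def mat_scale_def sum_distrib_left)

lemma sl2hat_loop: "trace A = 0 \<Longrightarrow> loop A m \<in> sl2hat"
  by (simp add: sl2hat_def loop_def lookup_single when_def)

lemma sl2hat_basic [simp]:
  "loop mat_x m \<in> sl2hat" "loop mat_y m \<in> sl2hat" "loop mat_h m \<in> sl2hat"
  "central \<in> sl2hat" "deriv_d \<in> sl2hat" "0 \<in> sl2hat"
  by (simp_all add: sl2hat_loop mat2_simps) (simp_all add: sl2hat_def central_def deriv_d_def zero_prod_def)

lemma sl2hat_add [simp]: "X \<in> sl2hat \<Longrightarrow> Y \<in> sl2hat \<Longrightarrow> X + Y \<in> sl2hat"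
  by (auto simp: sl2hat_def lookup_add trace_add)

lemma sl2hat_scale [simp]: "X \<in> sl2hat \<Longrightarrow> aff_scale z X \<in> sl2hat"
  by (auto simp: sl2hat_def aff_scale_def trace_mat_scale_1)

lemma sl2hat_sum: "(\<And>i. i \<in> S \<Longrightarrow> X i \<in> sl2hat) \<Longrightarrow> sum X S \<in> sl2hat"
  by (induction S rule: infinite_finite_induct) auto

lemma sl2hat_bracket: "X \<in> sl2hat \<Longrightarrow> Y \<in> sl2hat \<Longrightarrow> bracket X Y \<in> sl2hat"
proof -
  assume XY: "X \<in> sl2hat" "Y \<in> sl2hat"
  have K: "Poly_Mapping.lookup (sum g S) m = (\<Sum>i\<in>S. Poly_Mapping.lookup (g i) m)"
    for g :: "int \<Rightarrow> (int \<Rightarrow>\<^sub>0 mat2)" and S m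
    by (simp add: lookup_sum)
  have T: "trace (Poly_Mapping.lookup (Poly_Mapping.single k A) m) = (if k = m then trace A else 0)"
    for k m and A :: mat2
    by (simp add: lookup_single when_def)
  obtain p a b q a' b' where e: "X = (p, a, b)" "Y = (q, a', b')"
    by (metis prod_cases3)
  have pq: "trace (Poly_Mapping.lookup p m) = 0" "trace (Poly_Mapping.lookup q m) = 0" for m
    using XY by (auto simp: sl2hat_def e)
  show ?thesis
    by (auto simp: e bracket_def sl2hat_def lookup_add lookup_minus trace_add trace_sub
        loop_commutator_def loop_deriv_def lookup_sum trace_sum T trace_commutator trace_mat_scale_1 pq
        intro!: sum.neutral)
qed

lemma loop_scale: "loop (mat_scale z A) m = aff_scale z (loop A m)"
  by (simp add: loop_def aff_scale_def)

lemma loop_add: "loop (A + B) m = loop A m + loop B m"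
  by (simp add: loop_def single_add)

lemma sum_single_lookup:
  "(\<Sum>m\<in>Poly_Mapping.keys p. Poly_Mapping.single m (Poly_Mapping.lookup p m)) = p"
  by (rule poly_mapping_eqI) (simp add: lookup_sum lookup_single when_def in_keys_iff)

lemma loop_0 [simp]: "loop 0 m = 0"
  by (simp add: loop_def zero_prod_def)

section \<open>Submodules generated by a vector, and a grading on them\<close>

context sl2hat_module
begin

lemma module_hom_act: "X \<in> sl2hat \<Longrightarrow> module_hom smul smul (act X)"
  using act_linear by (rule Vector_Spaces.linear.axioms(3))

lemma act_add_right: "X \<in> sl2hat \<Longrightarrow> act X (u + w) = act X u + act X w"
  by (rule module_hom.add) (rule module_hom_act)

lemma act_scale_right: "X \<in> sl2hat \<Longrightarrow> act X (smul z u) = smul z (act X u)"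
  by (rule module_hom.scale) (rule module_hom_act)

lemma act_zero_right: "X \<in> sl2hat \<Longrightarrow> act X 0 = 0"
  by (rule module_hom.zero) (rule module_hom_act)

lemma additive_act: "X \<in> sl2hat \<Longrightarrow> Modules.additive (act X)"
  by (simp add: Modules.additive_def act_add_right)

lemma act_0 [simp]: "act 0 u = 0"
  using act_add[of 0 0 u] by simp

lemma act_sum: "(\<And>i. i \<in> S \<Longrightarrow> X i \<in> sl2hat) \<Longrightarrow> act (sum X S) u = (\<Sum>i\<in>S. act (X i) u)"
  by (induction S rule: infinite_finite_induct) (auto simp: act_add sl2hat_sum)

lemma act_central_comm: "X \<in> sl2hat \<Longrightarrow> act central (act X u) = act X (act central u)"
  using act_bracket[of central X u] by (simp add: bracket_central)

lemma act_loop_loop: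
  assumes "trace A = 0" "trace B = 0" "m + n \<noteq> 0 \<or> m = 0 \<or> trace (A ** B) = 0"
  shows "act (loop A m) (act (loop B n) u)
    = act (loop B n) (act (loop A m) u) + act (loop (commutator A B) (m + n)) u"
proof -
  have "bracket (loop A m) (loop B n) = loop (commutator A B) (m + n)"
    using assms(3) by (auto simp: bracket_loop aff_scale_def central_def zero_prod_def)
  then show ?thesis
    using act_bracket[of "loop A m" "loop B n" u] assms(1,2) by (simp add: sl2hat_loop algebra_simps)
qed

lemma act_decomp:
  assumes "(p, a, b) \<in> sl2hat"
  shows "act (p, a, b) u = (\<Sum>m\<in>Poly_Mapping.keys p.
      smul (Poly_Mapping.lookup p m $ 1 $ 2) (act (loop mat_x m) u)
      + smul (Poly_Mapping.lookup p m $ 2 $ 1) (act (loop mat_y m) u)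
      + smul (Poly_Mapping.lookup p m $ 1 $ 1) (act (loop mat_h m) u))
    + smul a (act central u) + smul b (act deriv_d u)"
proof -
  have t: "trace (Poly_Mapping.lookup p m) = 0" for m using assms by (simp add: sl2hat_def)
  have S: "(\<Sum>m\<in>S. loop (g m) m) = (\<Sum>m\<in>S. Poly_Mapping.single m (g m), 0, 0)" for S and g :: "int \<Rightarrow> mat2"
    by (induction S rule: infinite_finite_induct) (simp_all add: loop_def zero_prod_def)
  have "(p, a, b) = (\<Sum>m\<in>Poly_Mapping.keys p. loop (Poly_Mapping.lookup p m) m)
      + aff_scale a central + aff_scale b deriv_d"
    by (simp add: S sum_single_lookup aff_scale_def central_def deriv_d_def)
  moreover have "act (loop (Poly_Mapping.lookup p m) m) u
      = smul (Poly_Mapping.lookup p m $ 1 $ 2) (act (loop mat_x m) u)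
      + smul (Poly_Mapping.lookup p m $ 2 $ 1) (act (loop mat_y m) u)
      + smul (Poly_Mapping.lookup p m $ 1 $ 1) (act (loop mat_h m) u)" for m
    by (subst trace_zero_decomp[OF t]) (simp add: loop_add loop_scale act_add act_scale)
  ultimately show ?thesis
    by (simp add: act_add act_scale act_sum sl2hat_sum sl2hat_loop t)
qed

lemma act_in_subspace:
  assumes "subspace W" "X \<in> sl2hat"
    and "\<And>m. act (loop mat_x m) u \<in> W" "\<And>m. act (loop mat_y m) u \<in> W"
      "\<And>m. act (loop mat_h m) u \<in> W" "act central u \<in> W" "act deriv_d u \<in> W"
  shows "act X u \<in> W"
proof -
  obtain p a b where X: "X = (p, a, b)" by (metis prod_cases3)
  show ?thesis
    unfolding X using assms
    by (subst act_decomp) (auto simp: X intro!: subspace_add subspace_scale subspace_sum)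
qed

text \<open>The admissible \<open>loop A m\<close> form a basis of the negative part of the
  triangular decomposition, so for a singular \<open>w\<close> these words span the submodule that
  \<open>w\<close> generates.\<close>

inductive_set lowerings :: "'v \<Rightarrow> 'v set" for w where
  base: "w \<in> lowerings w"
| step: "u \<in> lowerings w \<Longrightarrow> A = mat_y \<and> m \<le> 0 \<or> (A = mat_x \<or> A = mat_h) \<and> m < 0
    \<Longrightarrow> act (loop A m) u \<in> lowerings w"

lemma lowering_in_sl2hat:
  "A = mat_y \<and> m \<le> 0 \<or> (A = mat_x \<or> A = mat_h) \<and> m < 0 \<Longrightarrow> loop A m \<in> sl2hat"
  by auto

lemma span_lowerings_step:
  assumes "u \<in> span (lowerings w)" "A = mat_y \<and> m \<le> 0 \<or> (A = mat_x \<or> A = mat_h) \<and> m < 0"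
  shows "act (loop A m) u \<in> span (lowerings w)"
  using assms(1)
proof (induction rule: span_induct_alt)
  case base
  then show ?case
    using lowering_in_sl2hat[OF assms(2)] by (simp add: act_zero_right span_zero)
next
  case (step c u u')
  then show ?case
    using lowering_in_sl2hat[OF assms(2)] lowerings.step[OF step(1) assms(2)]
    by (simp add: act_add_right act_scale_right span_add span_scale span_base)
qed

text \<open>Moving \<open>X\<close> past the outermost letter of a word leaves a bracket acting on a
  shorter word. The induction is over all \<open>X\<close> at once, so it covers this bracket
  too.\<close>

lemma span_lowerings_act:
  assumes w: "\<And>X. X \<in> sl2hat \<Longrightarrow> act X w \<in> span (lowerings w)"
    and u: "u \<in> span (lowerings w)" and X: "X \<in> sl2hat"
  shows "act X u \<in> span (lowerings w)"
proof -
  have *: "\<forall>X\<in>sl2hat. act X u \<in> span (lowerings w)" if "u \<in> lowerings w" for u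
    using that
  proof induction
    case base
    then show ?case using w by blast
  next
    case (step u A m)
    show ?case
    proof
      fix X assume X: "X \<in> sl2hat"
      have "act X (act (loop A m) u) = act (loop A m) (act X u) + act (bracket X (loop A m)) u"
        using act_bracket[OF X lowering_in_sl2hat[OF step(2)]] by simp
      also have "\<dots> \<in> span (lowerings w)"
        using step X lowering_in_sl2hat[OF step(2)]
        by (intro span_add span_lowerings_step) (auto intro: sl2hat_bracket)
      finally show "act X (act (loop A m) u) \<in> span (lowerings w)" .
    qed
  qed
  show ?thesis
    using u
  proof (induction rule: span_induct_alt)
    case base
    then show ?case using X by (simp add: act_zero_right span_zero)
  next
    case (step c u u')
    then show ?case
      using X * by (simp add: act_add_right act_scale_right span_add span_scale)
  qed
qed

text \<open>Both simple roots take the value 2 here: \<open>x\<close> has degree 2 and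
  \<open>y t\<close> has degree -2 + 4. Hence all lowering operators have negative degree, including
  \<open>y\<close>, which \<open>deriv_d\<close> alone does not see.\<close>

definition grading :: affine where
  "grading = loop mat_h 0 + aff_scale 4 deriv_d"

lemma grading_in_sl2hat: "grading \<in> sl2hat"
  by (simp add: grading_def)

lemma act_grading_lowering:
  assumes "A = mat_y \<and> m \<le> 0 \<or> (A = mat_x \<or> A = mat_h) \<and> m < 0"
  obtains k :: nat where
    "\<And>u. act grading (act (loop A m) u) = act (loop A m) (act grading u) - smul (of_nat k) (act (loop A m) u)"
proof -
  define e :: int where "e = (if A = mat_y then -2 else if A = mat_x then 2 else 0) + 4 * m"
  have ne: "mat_x \<noteq> mat_y" "mat_h \<noteq> mat_y" "mat_h \<noteq> mat_x"
    by (auto simp: mat_x_def mat_y_def mat_h_def vec_eq_iff forall_2 vector_2)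
  have "bracket grading (loop A m) = aff_scale (of_int e) (loop A m)"
    using assms ne unfolding grading_def bracket_add_left bracket_scale_left bracket_deriv_loop bracket_loop
    by (auto simp: e_def mat2_simps loop_scale aff_scale_def loop_def central_def mat_scale_mat_scale
        mat_scale_add simp flip: single_add)
  then have "act grading (act (loop A m) u) = act (loop A m) (act grading u) + smul (of_int e) (act (loop A m) u)" for u
    using act_bracket[OF grading_in_sl2hat lowering_in_sl2hat[OF assms], of u]
    by (simp add: act_scale lowering_in_sl2hat[OF assms])
  moreover have "of_int e = - (of_nat (nat (- e)) :: complex)"
    using assms ne by (auto simp: e_def)
  ultimately show thesis using that[of "nat (- e)"] by (simp add: scale_minus_left)
qed

lemma grading_lowerings:
  assumes "act grading w = smul (- of_nat k) w" "k > 0" "u \<in> lowerings w"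
  shows "\<exists>k>0. act grading u = smul (- of_nat k) u"
  using assms(3)
proof induction
  case base
  then show ?case using assms by blast
next
  case (step u A m)
  then obtain k where k: "k > 0" "act grading u = smul (- of_nat k) u" by blast
  obtain j :: nat where j:
    "act grading (act (loop A m) u) = act (loop A m) (act grading u) - smul (of_nat j) (act (loop A m) u)"
    using act_grading_lowering[OF step(2)] by blast
  have "act (loop A m) (act grading u) = smul (- of_nat k) (act (loop A m) u)"
    unfolding k(2) using lowering_in_sl2hat[OF step(2)] by (rule act_scale_right)
  then have "act grading (act (loop A m) u) = smul (- of_nat (k + j)) (act (loop A m) u)"
    unfolding j by (simp add: scale_left_diff_distrib)
  then show ?case using k(1) by (intro exI[of _ "k + j"]) simp
qed

text \<open>Applying \<open>(g + 1) (g + 2) \<dots> (g + n)\<close>, with \<open>g\<close> the grading operator, separates the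
  eigenvalue \<open>0\<close> from the negative integers.\<close>

lemma span_lowerings_no_weight_zero:
  assumes w: "act grading w = smul (- of_nat k) w" "k > 0"
    and u: "u \<in> span (lowerings w)" "act grading u = 0"
  shows "u = 0"
proof -
  define T where "T j u = act grading u + smul (of_nat j) u" for j u
  define D where "D n = fold T [1..<Suc n]" for n
  have T_lin: "T j (u + u') = T j u + T j u'" "T j (smul z u) = smul z (T j u)" "T j 0 = 0" for j u u' z
    by (simp_all add: T_def act_add_right act_scale_right act_zero_right grading_in_sl2hat
        scale_right_distrib mult.commute)
  have D_Suc: "D (Suc n) u = T (Suc n) (D n u)" for n u
    by (simp add: D_def)
  have D_lin: "D n (u + u') = D n u + D n u'" "D n (smul z u) = smul z (D n u)" "D n 0 = 0" for n u u' z
    by (induction n) (simp_all add: D_Suc T_lin, simp_all add: D_def)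
  have D_mono: "D m u = 0" if "D n u = 0" "n \<le> m" for n m u
    using that(2,1) by (induction rule: dec_induct) (simp_all add: D_Suc T_lin)
  have D_eig: "D n u = smul (\<Prod>j=1..n. of_nat j - a) u" if "act grading u = smul (- a) u" for n u a
  proof (induction n)
    case (Suc n)
    then show ?case
      using that by (simp add: D_Suc T_lin) (simp add: T_def algebra_simps)
  qed (simp add: D_def)
  have "\<exists>n. D n u = 0"
    using u(1)
  proof (induction rule: span_induct_alt)
    case base
    then show ?case by (simp add: D_lin)
  next
    case (step c u u')
    then obtain n where n: "D n u' = 0" by blast
    obtain k where k: "k > 0" "act grading u = smul (- of_nat k) u"
      using grading_lowerings[OF w step(1)] by blast
    have "D k u = 0"
      unfolding D_eig[OF k(2)] using k(1) by (subst prod_zero) (auto intro!: bexI[of _ k])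
    then have "D (max k n) u = 0" "D (max k n) u' = 0"
      using n D_mono by (metis max.cobounded1, metis max.cobounded2)
    then show ?case by (intro exI[of _ "max k n"]) (simp add: D_lin)
  qed
  then obtain n where "D n u = 0" by blast
  \<comment> \<open>On the kernel of \<open>grading\<close> the same operator is multiplication by
    \<open>n!\<close>, which is not zero.\<close>
  moreover have "D n u = smul (\<Prod>j=1..n. of_nat j - 0) u" by (rule D_eig) (simp add: u)
  ultimately show "u = 0" by (simp add: prod_zero_iff)
qed

end

section \<open>Operators annihilating the highest weight vector\<close>

locale basic_representation = irreducible_highest_weight_module smul act Lambda0 hwv
  for smul :: "complex \<Rightarrow> 'v \<Rightarrow> 'v::ab_group_add" and act and hwv
begin

lemma cartan_hwv:
  "act central hwv = hwv" "act deriv_d hwv = 0" "act (loop mat_h 0) hwv = 0"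
proof -
  have "aff_scale u (loop mat_h 0) + aff_scale a central + aff_scale b deriv_d \<in> cartan" for u a b
    unfolding cartan_def by blast
  from hwv_weight[OF this]
  have *: "act (aff_scale u (loop mat_h 0) + aff_scale a central + aff_scale b deriv_d) hwv = smul a hwv" for u a b
    by (simp add: Lambda0_cartan)
  show "act central hwv = hwv" "act deriv_d hwv = 0" "act (loop mat_h 0) hwv = 0"
    using *[of 0 1 0] *[of 0 0 1] *[of 1 0 0]
    by (simp_all add: aff_scale_def central_def deriv_d_def loop_def)
qed

text \<open>Only \<open>x\<close> and \<open>y t\<close> are given to kill \<open>hwv\<close>. Their
  bracket is \<open>h t\<close>, and bracketing with \<open>h t\<close> raises the power of
  \<open>t\<close> in \<open>y t^k\<close>, up to the factor -2.\<close>

lemma y_hwv_pos: "act (loop mat_y (int (Suc k))) hwv = 0"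
proof (induction k)
  case 0
  then show ?case using hwv_e0 by (simp add: chev_e0_def)
next
  case (Suc k)
  have y1: "act (loop mat_y 1) hwv = 0" using hwv_e0 by (simp add: chev_e0_def)
  have "act (loop mat_h 1) hwv = 0"
    using act_loop_loop[of mat_x mat_y 0 1 hwv] hwv_e1 y1
    by (simp add: mat2_simps chev_e1_def act_zero_right)
  then have "act (loop (mat_scale (-2) mat_y) (1 + int (Suc k))) hwv = 0"
    using act_loop_loop[of mat_h mat_y 1 "int (Suc k)" hwv] Suc
    by (simp add: mat2_simps act_zero_right)
  then show ?case by (simp add: loop_scale act_scale add.commute)
qed

lemma h_hwv: "m \<ge> 0 \<Longrightarrow> act (loop mat_h m) hwv = 0"
proof -
  assume "m \<ge> 0"
  then consider "m = 0" | k where "m = int (Suc k)"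
    by (metis nonneg_int_cases not0_implies_Suc of_nat_0)
  then show ?thesis
  proof cases
    case 1
    then show ?thesis using cartan_hwv by simp
  next
    case (2 k)
    then show ?thesis
      using act_loop_loop[of mat_x mat_y 0 m hwv] hwv_e1 y_hwv_pos[of k]
      by (simp add: mat2_simps chev_e1_def act_zero_right)
  qed
qed

lemma x_hwv: "m \<ge> 0 \<Longrightarrow> act (loop mat_x m) hwv = 0"
proof -
  assume m: "m \<ge> 0"
  have "act (loop (mat_scale 2 mat_x) m) hwv = 0"
    using act_loop_loop[of mat_h mat_x m 0 hwv] hwv_e1 h_hwv[OF m]
    by (simp add: mat2_simps chev_e1_def act_zero_right)
  then show ?thesis by (simp add: loop_scale act_scale)
qed

text \<open>The vector \<open>y v\<close> is singular of negative degree, so by irreducibility it vanishes.\<close>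

lemma y_hwv_0: "act (loop mat_y 0) hwv = 0"
proof (rule ccontr)
  define w where "w = act (loop mat_y 0) hwv"
  assume "act (loop mat_y 0) hwv \<noteq> 0"
  then have w0: "w \<noteq> 0" by (simp add: w_def)
  let ?W = "span (lowerings w)"
  have w_in: "w \<in> ?W" by (intro span_base lowerings.base)
  have hw: "act (loop mat_h m) w = (if m = 0 then smul (-2) w else 0)" if "m \<ge> 0" for m
  proof -
    have "act (loop mat_h m) w = act (loop mat_y 0) (act (loop mat_h m) hwv) + smul (-2) (act (loop mat_y m) hwv)"
      unfolding w_def using act_loop_loop[of mat_h mat_y m 0 hwv]
      by (simp add: mat2_simps loop_scale act_scale)
    then show ?thesis
      using that y_hwv_pos[of "nat m - 1"] by (auto simp: h_hwv act_zero_right w_def Suc_diff_le)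
  qed
  have d: "act deriv_d w = 0"
    unfolding w_def using act_bracket[of deriv_d "loop mat_y 0" hwv]
    by (simp add: bracket_deriv_loop act_scale cartan_hwv act_zero_right)
  have act_w: "act X w \<in> ?W" if "X \<in> sl2hat" for X
  proof (rule act_in_subspace[OF subspace_span that])
    fix m :: int
    show "act (loop mat_h m) w \<in> ?W"
      using hw[of m] w_in span_lowerings_step[OF w_in, of mat_h m]
      by (cases "m \<ge> 0") (auto intro: span_neg span_scale span_zero)
    show "act (loop mat_x m) w \<in> ?W"
    proof (cases "m \<ge> 0")
      case True
      \<comment> \<open>What remains is \<open>h t^m\<close> on \<open>hwv\<close>. It vanishes also
        for \<open>m = 0\<close> because \<open>Lambda0\<close> is zero on \<open>h\<close>; this
        makes \<open>w\<close> singular.\<close>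
      then have "act (loop mat_x m) w = 0"
        unfolding w_def using act_loop_loop[of mat_x mat_y m 0 hwv]
        by (simp add: mat2_simps x_hwv h_hwv act_zero_right)
      then show ?thesis by (simp add: span_zero)
    qed (use span_lowerings_step[OF w_in, of mat_x m] in auto)
    show "act (loop mat_y m) w \<in> ?W"
    proof (cases "m > 0")
      case True
      then have "act (loop mat_y m) w = 0"
        unfolding w_def using act_loop_loop[of mat_y mat_y m 0 hwv] y_hwv_pos[of "nat m - 1"]
        by (simp add: mat2_simps act_zero_right Suc_diff_le)
      then show ?thesis by (simp add: span_zero)
    qed (use span_lowerings_step[OF w_in, of mat_y m] in auto)
    show "act central w \<in> ?W"
      using w_in by (simp add: w_def act_central_comm cartan_hwv)
    show "act deriv_d w \<in> ?W" by (simp add: d span_zero)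
  qed
  \<comment> \<open>As \<open>w\<close> is not zero, the span would be everything and contain
    \<open>hwv\<close>. But \<open>hwv\<close> has degree 0, and the span starts in degree -2 and
    only goes down.\<close>
  have "?W = {0} \<or> ?W = UNIV"
    by (rule irreducible[OF subspace_span]) (rule span_lowerings_act[OF act_w])
  then have "hwv \<in> ?W" using w_in w0 by auto
  moreover have "act grading w = smul (- of_nat 2) w"
    by (simp add: grading_def act_add act_scale hw d)
  moreover have "act grading hwv = 0"
    by (simp add: grading_def act_add act_scale cartan_hwv)
  ultimately have "hwv = 0" using span_lowerings_no_weight_zero[of w 2 hwv] by simp
  then show False using hwv_nonzero by simp
qed

lemma y_hwv: "m \<ge> 0 \<Longrightarrow> act (loop mat_y m) hwv = 0"
  using y_hwv_0 y_hwv_pos[of "nat m - 1"] by (cases "m = 0") (auto simp: Suc_diff_le)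

end

section \<open>Polynomials in the \<open>h t^-j\<close> as operators\<close>

lemma funpow_commute_comp:
  assumes "f \<circ> g = g \<circ> f"
  shows "(f ^^ a) \<circ> (g ^^ b) = (g ^^ b) \<circ> (f ^^ a)"
proof -
  have *: "f \<circ> (g ^^ b) = (g ^^ b) \<circ> f" if "f \<circ> g = g \<circ> f" for f g :: "'a \<Rightarrow> 'a" and b
  proof (induction b)
    case (Suc b)
    have "f \<circ> (g ^^ Suc b) = (f \<circ> g) \<circ> (g ^^ b)" by (simp add: comp_assoc)
    also have "\<dots> = g \<circ> (f \<circ> (g ^^ b))" by (simp only: that comp_assoc)
    also have "\<dots> = (g ^^ Suc b) \<circ> f" by (simp only: Suc) (simp add: fun_eq_iff)
    finally show ?case .
  qed simp
  show ?thesis using *[OF *[OF assms, symmetric], of b a] *[of "g ^^ b" f a] * assms by metis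
qed

context sl2hat_module
begin

definition hop :: "nat \<Rightarrow> 'v \<Rightarrow> 'v" where "hop j = act (loop mat_h (- int j))"

lemma hop_commute: "hop i \<circ> hop j = hop j \<circ> hop i"
  unfolding hop_def fun_eq_iff comp_def by (subst act_loop_loop) (auto simp: mat2_simps)

sublocale hop: comp_fun_commute "\<lambda>j. hop j ^^ Poly_Mapping.lookup e j" for e :: "nat \<Rightarrow>\<^sub>0 nat"
  by unfold_locales (rule funpow_commute_comp[OF hop_commute])

text \<open>The \<open>hop j\<close> commute and exponent 0 gives the identity, so a common index
  set can serve monomials with different variables.\<close>

lemma hmonom_act_superset:
  assumes "finite S" "Poly_Mapping.keys e \<subseteq> S"
  shows "hmonom_act act e u = Finite_Set.fold (\<lambda>j. hop j ^^ Poly_Mapping.lookup e j) u S"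
proof -
  let ?f = "\<lambda>j. hop j ^^ Poly_Mapping.lookup e j"
  let ?l = "sorted_list_of_set (Poly_Mapping.keys e)"
  have "hmonom_act act e u = fold ?f (rev ?l) u"
    by (simp add: hmonom_act_def foldr_conv_fold flip: hop_def)
  also have "\<dots> = Finite_Set.fold ?f u (set (rev ?l))"
    by (subst hop.fold_set_fold_remdups) (simp add: distinct_remdups_id)
  also have "set (rev ?l) = Poly_Mapping.keys e" by simp
  also have "Finite_Set.fold ?f u (Poly_Mapping.keys e)
      = Finite_Set.fold ?f u (Poly_Mapping.keys e \<union> (S - Poly_Mapping.keys e))"
  proof -
    have *: "Finite_Set.fold ?f u (Poly_Mapping.keys e \<union> T) = Finite_Set.fold ?f u (Poly_Mapping.keys e)"
      if "finite T" "T \<inter> Poly_Mapping.keys e = {}" for T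
      using that by (induction T rule: finite_induct) (auto simp: in_keys_iff)
    show ?thesis by (rule *[symmetric]) (use assms(1) in auto)
  qed
  also have "Poly_Mapping.keys e \<union> (S - Poly_Mapping.keys e) = S" using assms(2) by auto
  finally show ?thesis .
qed

lemma hmonom_act_single_add:
  "hmonom_act act (Poly_Mapping.single d 1 + e) u = hmonom_act act e (hop d u)"
proof -
  define S where "S = Poly_Mapping.keys e - {d}"
  let ?f = "\<lambda>e j. hop j ^^ Poly_Mapping.lookup e j"
  have S: "finite (insert d S)" "d \<notin> S" "Poly_Mapping.keys e \<subseteq> insert d S"
    by (auto simp: S_def)
  have S': "Poly_Mapping.keys (Poly_Mapping.single d 1 + e) \<subseteq> insert d S"
    using keys_add[of "Poly_Mapping.single d 1" e] S(3) by auto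
  have eq: "Finite_Set.fold (?f (Poly_Mapping.single d 1 + e)) u' T = Finite_Set.fold (?f e) u' T"
    if "finite T" "d \<notin> T" for T u'
    using that
  proof (induction T rule: finite_induct)
    case (insert x T)
    then have "?f (Poly_Mapping.single d 1 + e) x = ?f e x" by (simp add: lookup_add lookup_single)
    then show ?case
      using insert.IH insert.prems unfolding hop.fold_insert[OF insert.hyps] by simp
  qed simp
  have "hmonom_act act (Poly_Mapping.single d 1 + e) u
      = Finite_Set.fold (?f (Poly_Mapping.single d 1 + e)) ((hop d ^^ Suc (Poly_Mapping.lookup e d)) u) S"
    unfolding hmonom_act_superset[OF S(1) S'] using S by (subst hop.fold_insert2) (auto simp: lookup_add)
  also have "\<dots> = Finite_Set.fold (?f e) ((hop d ^^ Poly_Mapping.lookup e d) (hop d u)) S"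
    using S by (subst eq) (auto simp: funpow_swap1)
  also have "\<dots> = hmonom_act act e (hop d u)"
    unfolding hmonom_act_superset[OF S(1) S(3)] using S by (subst hop.fold_insert2) auto
  finally show ?thesis .
qed

lemma hmonom_act_0: "hmonom_act act 0 u = u"
  by (simp add: hmonom_act_def)

lemma hmonom_act_scale: "hmonom_act act e (smul z u) = smul z (hmonom_act act e u)"
proof -
  have p: "(hop j ^^ k) (smul z u) = smul z ((hop j ^^ k) u)" for j k u
    by (induction k) (auto simp: hop_def act_scale_right)
  have "Finite_Set.fold (\<lambda>j. hop j ^^ Poly_Mapping.lookup e j) (smul z u) S
      = smul z (Finite_Set.fold (\<lambda>j. hop j ^^ Poly_Mapping.lookup e j) u S)" if "finite S" for S
    using that by (induction S rule: finite_induct) (auto simp: p)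
  then show ?thesis by (simp add: hmonom_act_superset[OF finite_keys order_refl])
qed

lemma hpoly_act_superset:
  assumes "finite S" "Poly_Mapping.keys P \<subseteq> S"
  shows "hpoly_act smul act P u = (\<Sum>e\<in>S. smul (Poly_Mapping.lookup P e) (hmonom_act act e u))"
  unfolding hpoly_act_def
  by (intro sum.mono_neutral_left) (use assms in \<open>auto simp: in_keys_iff\<close>)

lemma additive_hpoly_act: "Modules.additive (\<lambda>P. hpoly_act smul act P u)"
proof
  fix P Q :: hpoly
  define S where "S = Poly_Mapping.keys P \<union> Poly_Mapping.keys Q"
  have S: "finite S" "Poly_Mapping.keys P \<subseteq> S" "Poly_Mapping.keys Q \<subseteq> S"
      "Poly_Mapping.keys (P + Q) \<subseteq> S"
    using keys_add[of P Q] by (auto simp: S_def)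
  show "hpoly_act smul act (P + Q) u = hpoly_act smul act P u + hpoly_act smul act Q u"
    unfolding S(2-4)[THEN hpoly_act_superset[OF S(1)]]
    by (simp add: lookup_add scale_left_distrib sum.distrib)
qed

lemma hpoly_act_single: "hpoly_act smul act (Poly_Mapping.single e a) u = smul a (hmonom_act act e u)"
  by (cases "a = 0") (simp_all add: hpoly_act_def)

lemma hpoly_act_hvar_mult: "hpoly_act smul act (hvar d * P) u = hpoly_act smul act P (hop d u)"
proof -
  have "hvar d * P = hvar d * (\<Sum>e\<in>Poly_Mapping.keys P. Poly_Mapping.single e (Poly_Mapping.lookup P e))"
    by (simp add: sum_single_lookup)
  also have "\<dots> = (\<Sum>e\<in>Poly_Mapping.keys P.
      Poly_Mapping.single (Poly_Mapping.single d 1 + e) (Poly_Mapping.lookup P e))"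
    by (simp add: sum_distrib_left hvar_def mult_single)
  finally show ?thesis
    by (simp add: Modules.additive.sum[OF additive_hpoly_act] hpoly_act_single hmonom_act_single_add
        del: One_nat_def) (simp add: hpoly_act_def)
qed

lemma hpoly_act_hconst_mult: "hpoly_act smul act (hconst a * P) u = smul a (hpoly_act smul act P u)"
proof -
  have "hconst a * P = hconst a * (\<Sum>e\<in>Poly_Mapping.keys P. Poly_Mapping.single e (Poly_Mapping.lookup P e))"
    by (simp add: sum_single_lookup)
  also have "\<dots> = (\<Sum>e\<in>Poly_Mapping.keys P. Poly_Mapping.single e (a * Poly_Mapping.lookup P e))"
    by (simp add: sum_distrib_left hconst_def mult_single)
  finally show ?thesis
    by (simp add: Modules.additive.sum[OF additive_hpoly_act] hpoly_act_single)
      (simp add: hpoly_act_def scale_sum_right)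
qed

lemma hpoly_act_1: "hpoly_act smul act 1 u = u"
  using hpoly_act_single[of 0 1 u] by (simp add: hmonom_act_0)

lemma hpoly_act_minus_right: "hpoly_act smul act P (- u) = - hpoly_act smul act P u"
  using hmonom_act_scale[of _ "-1" u] by (simp add: hpoly_act_def sum_negf)

text \<open>Both sides obey the same recursion, by \<open>partition_sum_insert\<close>. Exponents
  are given as a function on distinct indices so that equal parts remain distinguishable. They have
  to be positive because \<open>p 0\<close> will carry the central term; merging keeps them
  positive.\<close>

lemma aug_monomial_eq_hpoly_act:
  assumes "\<And>j u. j > 0 \<Longrightarrow> p j u = - hop j u"
  shows "distinct xs \<Longrightarrow> (\<And>x. x \<in> set xs \<Longrightarrow> c x > 0) \<Longrightarrow>
    aug_monomial p (map c xs) u = hpoly_act smul act (partition_sum hvar (set xs) c) u"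
proof (induction xs arbitrary: c u)
  case Nil
  then show ?case by (simp add: partition_sum_empty hpoly_act_1)
next
  case (Cons x xs)
  let ?c = "\<lambda>j. c(j := c j + c x)"
  have upd: "(map c xs)[k := map c xs ! k + c x] = map (?c (xs ! k)) xs" if "k < length xs" for k
    using that Cons.prems(1) by (auto simp: list_eq_iff_nth_eq nth_list_update nth_eq_iff_index_eq)
  have IH: "aug_monomial p ((map c xs)[k := map c xs ! k + c x]) u
      = hpoly_act smul act (partition_sum hvar (set xs) (?c (xs ! k))) u" if "k < length xs" for k
    unfolding upd[OF that] by (rule Cons.IH) (use Cons.prems in auto)
  have "(\<Sum>k<length (map c xs). aug_monomial p ((map c xs)[k := map c xs ! k + c x]) u)
      = (\<Sum>k<length xs. hpoly_act smul act (partition_sum hvar (set xs) (?c (xs ! k))) u)"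
    by (intro sum.cong IH) auto
  also have "\<dots> = (\<Sum>j\<in>set xs. hpoly_act smul act (partition_sum hvar (set xs) (?c j)) u)"
    using Cons.prems(1)
    by (intro sum.reindex_bij_betw[of "(!) xs" _ _ "\<lambda>j. hpoly_act smul act (partition_sum hvar (set xs) (?c j)) u"])
      (simp add: bij_betw_nth)
  finally have S: "(\<Sum>k<length (map c xs). aug_monomial p ((map c xs)[k := map c xs ! k + c x]) u)
      = (\<Sum>j\<in>set xs. hpoly_act smul act (partition_sum hvar (set xs) (?c j)) u)" .
  have "aug_monomial p (map c xs) (p (c x) u) = - hpoly_act smul act (hvar (c x) * partition_sum hvar (set xs) c) u"
    using Cons.prems by (simp add: Cons.IH assms hpoly_act_hvar_mult hpoly_act_minus_right)
  then have "aug_monomial p (map c (x # xs)) u = hpoly_act smul act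
      (- (hvar (c x) * partition_sum hvar (set xs) c) - (\<Sum>j\<in>set xs. partition_sum hvar (set xs) (?c j))) u"
    unfolding list.map aug_monomial.simps S
    by (simp only: Modules.additive.diff[OF additive_hpoly_act] Modules.additive.minus[OF additive_hpoly_act]
        Modules.additive.sum[OF additive_hpoly_act])
  also have "- (hvar (c x) * partition_sum hvar (set xs) c) - (\<Sum>j\<in>set xs. partition_sum hvar (set xs) (?c j))
      = partition_sum hvar (set (x # xs)) c"
    using Cons.prems(1) by (simp add: partition_sum_insert)
  finally show ?case .
qed

end

section \<open>A current algebra inside the affine algebra\<close>

context basic_representation
begin

lemma act_yx:
  "act (loop mat_y m) (act (loop mat_x n) u) = act (loop mat_x n) (act (loop mat_y m) u)
    + (smul (if m = - n then of_int m else 0) (act central u) - act (loop mat_h (m + n)) u)"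
proof -
  have "bracket (loop mat_y m) (loop mat_x n)
      = aff_scale (-1) (loop mat_h (m + n)) + aff_scale (if m = - n then of_int m else 0) central"
    by (simp add: bracket_loop mat2_simps loop_scale)
  then show ?thesis
    using act_bracket[of "loop mat_y m" "loop mat_x n" u]
    by (simp add: act_add act_scale algebra_simps split del: if_split)
qed

text \<open>For natural \<open>a\<close> and \<open>b\<close>, \<open>N - a\<close> equals
  \<open>N + b\<close> only if both are 0, so the cocycle affects a single bracket and is absorbed
  into \<open>h 0\<close>. The other brackets have no central term, since \<open>mat_h\<close> is
  orthogonal to \<open>mat_x\<close> and \<open>mat_y\<close> under the trace form.\<close>

lemma current_sl2_shifted:
  "current_sl2 (\<lambda>a. act (loop mat_y (int N - int a))) (\<lambda>b. act (loop mat_x (- int N - int b)))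
    (\<lambda>c u. smul (if c = 0 then of_nat N else 0) (act central u) - hop c u)"
    (is "current_sl2 ?e ?f ?h")
proof
  show "?e a (u + w) = ?e a u + ?e a w" "?f a (u + w) = ?f a u + ?f a w"
    "?h a (u + w) = ?h a u + ?h a w" for a u w
    by (simp_all add: act_add_right hop_def scale_right_distrib)
  show "?f a (?f b u) = ?f b (?f a u)" for a b u
    by (subst act_loop_loop) (simp_all add: mat2_simps)
  show "?e a (?f b u) = ?f b (?e a u) + ?h (a + b) u" for a b u
  proof -
    have "(if int N - int a = - (- int N - int b) then of_int (int N - int a) else 0 :: complex)
        = (if a + b = 0 then of_nat N else 0)" by auto
    then show ?thesis unfolding act_yx by (simp add: hop_def algebra_simps split del: if_split)
  qed
  show "?h a (?f b u) = ?f b (?h a u) - (?f (a + b) u + ?f (a + b) u)" for a b u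
  proof -
    have "hop a (?f b u) = ?f b (hop a u) + smul 2 (?f (a + b) u)"
      unfolding hop_def
      by (subst act_loop_loop) (auto simp: mat2_simps loop_scale act_scale algebra_simps)
    moreover have "smul 2 w = w + w" for w
      using scale_left_distrib[of 1 1 w] by simp
    ultimately show ?thesis
      by (simp add: act_central_comm Modules.additive.diff[OF additive_act] act_scale_right algebra_simps)
  qed
  show "?e a (?h b u) = ?h b (?e a u) - (?e (a + b) u + ?e (a + b) u)" for a b u
  proof -
    have "?e a (hop b u) = hop b (?e a u) + smul 2 (?e (a + b) u)"
      unfolding hop_def
      by (subst act_loop_loop) (auto simp: mat2_simps loop_scale act_scale algebra_simps)
    moreover have "smul 2 w = w + w" for w
      using scale_left_distrib[of 1 1 w] by simp
    ultimately show ?thesis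
      by (simp add: act_central_comm Modules.additive.diff[OF additive_act] act_scale_right algebra_simps)
  qed
qed

lemma y_prod_x_power:
  assumes "length \<mu> = N" "sum_list \<mu> \<le> N"
  shows "fold (\<lambda>a. act (loop mat_y (int N - int a))) \<mu> ((act (loop mat_x (- int N)) ^^ N) hwv)
    = smul (fact N) (aug_monomial
        (\<lambda>c u. smul (if c = 0 then of_nat N else 0) (act central u) - hop c u) \<mu> hwv)"
proof -
  let ?f = "\<lambda>b. act (loop mat_x (- int N - int b))"
  interpret C: current_sl2 "\<lambda>a. act (loop mat_y (int N - int a))" ?f
    "\<lambda>c u. smul (if c = 0 then of_nat N else 0) (act central u) - hop c u"
    by (rule current_sl2_shifted)
  have F: "C.f_prod (\<lambda>_. 0) {..<k} hwv = (?f 0 ^^ k) hwv" for k :: nat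
    by (induction k) (simp_all add: C.f_prod_simps lessThan_Suc)
  have "fold (\<lambda>a. act (loop mat_y (int N - int a))) \<mu> (C.f_prod (\<lambda>_. 0) {..<N} hwv)
    = match_sum \<mu> {..<N} (\<lambda>_. 0) (\<lambda>c. aug_monomial
        (\<lambda>c u. smul (if c = 0 then of_nat N else 0) (act central u) - hop c u) c hwv)"
    \<comment> \<open>The bound is \<open>N\<close> because \<open>y t^(N - a)\<close> has a
      non-negative power of \<open>t\<close> exactly for \<open>a \<le> N\<close>; the extreme case
      \<open>a = N\<close> is \<open>y_hwv_0\<close>.\<close>
    using assms y_hwv by (intro C.e_prod_f_prod[where K = N]) auto
  then show ?thesis
    using assms by (simp add: F match_sum_0)
qed

end

section \<open>The vector \<open>c_vec\<close> at the middle level \<open>k = n / 2\<close>\<close>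

theorem theorem10:
  fixes smul :: "complex \<Rightarrow> 'v \<Rightarrow> 'v::ab_group_add"
    and act :: "affine \<Rightarrow> 'v \<Rightarrow> 'v" and v :: 'v
    and n :: nat and lam :: "nat \<Rightarrow> nat"
  assumes "irreducible_highest_weight_module smul act Lambda0 v"
    and "even n"
    and "(n, n div 2, lam) \<in> PP_stab n"
  shows "c_vec smul act v (n, n div 2, lam) = hpoly_act smul act (f_poly lam) v"
proof -
  interpret basic_representation smul act v
    using assms(1) by (rule basic_representation.intro)
  define N where "N = n div 2"
  define r where "r = psupp lam"
  have n: "n - N = N" using assms(2) by (auto simp: N_def)
  have lam: "is_partition lam" and lam0: "lam 0 \<le> N" and r: "r \<le> N" and size: "psize lam \<le> N"
    using assms(3) n by (auto simp: PP_stab_def PP_def r_def simp flip: N_def)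
  let ?h = "\<lambda>c u. smul (if c = 0 then of_nat N else 0) (act central u) - hop c u"
  \<comment> \<open>\<open>foldr\<close> applies index 0 last, whence the reversal. It also puts the
    zero parts in front, as \<open>aug_monomial_zeros\<close> requires.\<close>
  let ?\<mu> = "map lam (rev [0..<N])"
  have zero: "lam i = 0" if "i \<ge> r" for i
    using is_partition_pos_iff[OF lam, of i] that by (simp add: r_def)
  have \<mu>: "?\<mu> = replicate (N - r) 0 @ map lam (rev [0..<r])"
  proof -
    have "[0..<N] = [0..<r] @ [r..<N]" using r by (metis le_add_diff_inverse upt_add_eq_append zero_le)
    then have "?\<mu> = map lam (rev [r..<N]) @ map lam (rev [0..<r])" by simp
    moreover have "map lam (rev [r..<N]) = replicate (N - r) 0"
      using zero by (intro replicate_eqI) auto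
    ultimately show ?thesis by simp
  qed
  have "sum_list ?\<mu> = (\<Sum>i<r. lam i)"
    unfolding \<mu> using sum.distinct_set_conv_list[of "rev [0..<r]" lam]
    by (simp add: sum_list_replicate atLeast0LessThan)
  then have sum: "sum_list ?\<mu> \<le> N"
    using size by (simp add: psize_eq[OF lam] r_def)
  have fold_scale: "fold (\<lambda>a. act (loop mat_y (int N - int a))) \<nu> (smul z u)
      = smul z (fold (\<lambda>a. act (loop mat_y (int N - int a))) \<nu> u)" for \<nu> z u
    by (induction \<nu> arbitrary: u) (simp_all add: act_scale_right)
  have "foldr (\<lambda>i. act (loop mat_y (int N - int (lam i)))) [0..<N] (w_vec smul act v n)
      = fold (\<lambda>a. act (loop mat_y (int N - int a))) ?\<mu> (smul (1 / fact N) ((act (loop mat_x (- int N)) ^^ N) v))"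
    by (simp add: foldr_conv_fold fold_map comp_def w_vec_def divided_power_def flip: N_def)
  also have "\<dots> = aug_monomial ?h ?\<mu> v"
    using sum by (simp add: fold_scale y_prod_x_power)
  \<comment> \<open>On \<open>v\<close> the operator \<open>?h 0\<close> is multiplication by
    \<open>N = (N - r) + r\<close>.\<close>
  also have "\<dots> = smul (fact (N - r)) (aug_monomial ?h (map lam (rev [0..<r])) v)"
    unfolding \<mu> using r
    by (subst aug_monomial_zeros)
      (simp_all add: act_scale_right hop_def scale_right_diff_distrib cartan_hwv mult.commute)
  also have "aug_monomial ?h (map lam (rev [0..<r])) v
      = hpoly_act smul act (partition_sum hvar {..<r} lam) v"
    by (subst aug_monomial_eq_hpoly_act)
      (auto simp: r_def is_partition_pos_iff[OF lam] atLeast0LessThan)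
  finally have main: "foldr (\<lambda>i. act (loop mat_y (int N - int (lam i)))) [0..<N] (w_vec smul act v n)
      = smul (fact (N - r)) (hpoly_act smul act (partition_sum hvar {..<r} lam) v)" .
  \<comment> \<open>\<open>z_coeff\<close> multiplies up to \<open>k = N\<close>,
    \<open>f_poly\<close> only up to the largest part; larger values have multiplicity 0 and
    factorial 1.\<close>
  have "(\<Prod>j\<in>{1..lam 0}. fact (pmult lam j)) = (\<Prod>j\<in>{1..N}. fact (pmult lam j) :: complex)"
  proof (rule prod.mono_neutral_left)
    show "\<forall>j\<in>{1..N} - {1..lam 0}. fact (pmult lam j) = (1 :: complex)"
    proof
      fix j assume "j \<in> {1..N} - {1..lam 0}"
      moreover have "lam i \<le> lam 0" for i
        using lam by (auto simp: is_partition_def intro: antimonoD)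
      ultimately have "{i. lam i = j} = {}" by (fastforce simp: not_le)
      then show "fact (pmult lam j) = (1 :: complex)" by (simp add: pmult_def)
    qed
  qed (use lam0 in auto)
  \<comment> \<open>The exponent of -1 in \<open>z_coeff\<close> is therefore 0.\<close>
  moreover have "n div 4 = N div 2" by (simp add: N_def div_mult2_eq)
  ultimately have "z_coeff (n, N, lam) * fact (N - r) = 1 / (\<Prod>j\<in>{1..lam 0}. fact (pmult lam j))"
    by (simp add: z_coeff_def n r_def del: diff_diff_left)
  then show ?thesis
    unfolding N_def [symmetric]
    by (simp add: c_vec_def n main f_poly_eq[OF lam] hpoly_act_hconst_mult flip: r_def)
qed

end
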